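(* Let $d$ be a positive integer, let $G$ be a graph and let $u,v \in V(G)$ be a pair of vertices. If $\{u,v\}$ is $d$-stress-linked in $G$, then $\{u,v\}$ is globally linked in $G$ in $\mathbb{C}^d$.
   Context: Graphs are finite and simple, with a nonempty edge set; a pair of vertices consists of two distinct vertices; $d$ is a fixed positive integer. $G+uv$ is $G$ with the edge $uv$ added ($G+uv=G$ if $uv\in E(G)$). Let $G=(V,E)$. A realization (framework) of $G$ in $\mathbb{C}^d$ is a pair $(G,p)$ with $p:V\to\mathbb{C}^d$. It is generic if the $d|V|$ coordinates of $p$ do not satisfy any nonzero polynomial with rational coefficients. Put $m_{uv}(p)=\sum_{i=1}^d(p(u)_i-p(v)_i)^2$ and $m_{d,G}(p)=(m_{uv}(p))_{uv\in E}\in\mathbb{C}^E$. The generic rigidity matroid $\mathcal{R}_d(G)$ is the matroid on $E$ given by the rows of the Jacobian matrix of $m_{d,G}$ at any generic configuration $p$ (the result does not depend on $p$); $r_d(G)$ is its rank. A pair $\{u,v\}$ is $\mathcal{R}_d$-linked in $G$ if $r_d(G+uv)=r_d(G)$. A stress of $(G,p)$ is a vector $\omega\in\mathbb{C}^E$ with $\sum_{u:uv\in E}\omega_{uv}(p(u)-p(v))=0$ for every $v\in V$; $S(G,p)\subseteq\mathbb{C}^E$ is the linear space of stresses. Set $K_1(G,p)=\{q\in\mathbb{C}^V: S(G,p)\subseteq S(G,q)\}$, where $q$ is viewed as a one-dimensional realization; this is a linear space. Its dimension is the same for every generic $(G,p)$ in $\mathbb{C}^d$; this number is denoted $k_{d,G}$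 (shared stress nullity). A pair $\{u,v\}$ is $d$-stress-linked in $G$ if $\{u,v\}$ is $\mathcal{R}_d$-linked in $G$ and $k_{d,G+uv}=k_{d,G}$ (in particular this holds if $uv\in E$). A pair $\{u,v\}$ is globally linked in $G$ in $\mathbb{C}^d$ if for every generic framework $(G,p)$ in $\mathbb{C}^d$ and every framework $(G,q)$ in $\mathbb{C}^d$, $m_{d,G}(p)=m_{d,G}(q)$ implies $m_{uv}(p)=m_{uv}(q)$. *)

theory Defs
  imports "HOL-Analysis.Analysis" "HOL-Library.Poly_Mapping"
begin

text \<open>
  A graph has vertex set \<open>UNIV\<close> of a finite type \<open>'v\<close> and is given by its edge set, a set of
  two-element sets of vertices.  The dimension \<open>d\<close> is \<open>CARD('d)\<close>, so that realizations in
  \<open>\<complex>\<^sup>d\<close> have type \<open>complex ^ 'd ^ 'v\<close>; invariants that do not mention a realization take an argument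
  of type \<open>'d itself\<close>.  Elements of \<open>\<complex>\<^sup>E\<close> are functions on \<open>'v set\<close> that vanish outside \<open>E\<close>.
\<close>

definition simple_graph :: "'v::finite set set \<Rightarrow> bool" where
  "simple_graph E \<longleftrightarrow> E \<noteq> {} \<and> (\<forall>e\<in>E. card e = 2)"

definition add_edge :: "'v set set \<Rightarrow> 'v \<Rightarrow> 'v \<Rightarrow> 'v set set" where
  "add_edge E u v = insert {u, v} E"


subsection \<open>Generic realizations\<close>

definition mpoly_eval :: "(('x \<Rightarrow>\<^sub>0 nat) \<Rightarrow>\<^sub>0 rat) \<Rightarrow> ('x \<Rightarrow> complex) \<Rightarrow> complex" where
  "mpoly_eval P x =
     (\<Sum>m\<in>Poly_Mapping.keys P. of_rat (Poly_Mapping.lookup P m) *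
        (\<Prod>j\<in>Poly_Mapping.keys m. x j ^ Poly_Mapping.lookup m j))"

definition generic :: "complex ^ 'd::finite ^ 'v::finite \<Rightarrow> bool" where
  "generic p \<longleftrightarrow>
     \<not> (\<exists>P :: (('v \<times> 'd) \<Rightarrow>\<^sub>0 nat) \<Rightarrow>\<^sub>0 rat. P \<noteq> 0 \<and> mpoly_eval P (\<lambda>(w, i). p $ w $ i) = 0)"


subsection \<open>The measurement map and its Jacobian\<close>

definition sqdist :: "complex ^ 'd::finite ^ 'v::finite \<Rightarrow> 'v \<Rightarrow> 'v \<Rightarrow> complex" where
  "sqdist p u v = (\<Sum>i\<in>UNIV. (p $ u $ i - p $ v $ i)\<^sup>2)"

text \<open>By symmetry of \<open>sqdist\<close>, the description below determines the value for every pair \<open>e\<close>;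
  see \<open>edge_sqdist_pair\<close>.\<close>

definition edge_sqdist :: "complex ^ 'd::finite ^ 'v::finite \<Rightarrow> 'v set \<Rightarrow> complex" where
  "edge_sqdist p e = (THE c. \<exists>u v. e = {u, v} \<and> c = sqdist p u v)"

definition measurement ::
  "'v set set \<Rightarrow> complex ^ 'd::finite ^ 'v::finite \<Rightarrow> 'v set \<Rightarrow> complex" where
  "measurement E p e = (if e \<in> E then edge_sqdist p e else 0)"

definition update_coord ::
  "complex ^ 'd::finite ^ 'v::finite \<Rightarrow> 'v \<Rightarrow> 'd \<Rightarrow> complex \<Rightarrow> complex ^ 'd ^ 'v" where
  "update_coord p w i t = (\<chi> w' i'. if w' = w \<and> i' = i then t else p $ w' $ i')"

definition jacobian_row ::
  "'v set set \<Rightarrow> complex ^ 'd::finite ^ 'v::finite \<Rightarrow> 'v set \<Rightarrow> complex ^ ('v \<times> 'd)" where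
  "jacobian_row E p e =
     (\<chi> x. case x of (w, i) \<Rightarrow>
        deriv (\<lambda>t. measurement E (update_coord p w i t) e) (p $ w $ i))"

lemma sqdist_commute: "sqdist p u v = sqdist p v u"
  by (simp add: sqdist_def power2_commute)

lemma edge_sqdist_pair [simp]: "edge_sqdist p {u, v} = sqdist p u v"
  unfolding edge_sqdist_def
  by (rule the_equality) (auto simp: doubleton_eq_iff sqdist_commute)

lemma jacobian_row_pair:
  fixes p :: "complex ^ 'd::finite ^ 'v::finite"
  assumes "{u, v} \<in> E" and "u \<noteq> v"
  shows "jacobian_row E p {u, v} $ (w, i) =
    (if w = u then 2 * (p $ u $ i - p $ v $ i)
     else if w = v then 2 * (p $ v $ i - p $ u $ i) else 0)"
proof -
  let ?f = "\<lambda>t. \<Sum>j\<in>UNIV. ((if u = w \<and> j = i then t else p $ u $ j)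
                          - (if v = w \<and> j = i then t else p $ v $ j))\<^sup>2"
  let ?D = "if w = u then 2 * (p $ u $ i - p $ v $ i)
            else if w = v then 2 * (p $ v $ i - p $ u $ i) else 0"
  have "((\<lambda>t. ((if u = w \<and> j = i then t else p $ u $ j)
              - (if v = w \<and> j = i then t else p $ v $ j))\<^sup>2)
          has_field_derivative (if j = i then ?D else 0)) (at (p $ w $ i))" for j
    using assms(2)
    by (cases "j = i"; cases "w = u"; cases "w = v")
       (auto intro!: derivative_eq_intros)
  then have "(?f has_field_derivative (\<Sum>j\<in>UNIV. if j = i then ?D else 0)) (at (p $ w $ i))"
    by (intro DERIV_sum) auto
  then have "deriv ?f (p $ w $ i) = ?D"
    by (intro DERIV_imp_deriv) simp
  then show ?thesis
    using assms(1) by (simp add: jacobian_row_def measurement_def sqdist_def update_coord_def)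
qed


subsection \<open>The generic rigidity matroid\<close>

text \<open>Matroids are represented by their families of independent sets.\<close>

definition rigidity_matroid ::
  "'v set set \<Rightarrow> complex ^ 'd::finite ^ 'v::finite \<Rightarrow> 'v set set set" where
  "rigidity_matroid E p =
     {F. F \<subseteq> E \<and> inj_on (jacobian_row E p) F \<and> vec.independent (jacobian_row E p ` F)}"

definition generic_rigidity_matroid ::
  "'d::finite itself \<Rightarrow> 'v::finite set set \<Rightarrow> 'v set set set" where
  "generic_rigidity_matroid (TYPE('d)) E =
     (THE M. \<forall>p :: complex ^ 'd ^ 'v. generic p \<longrightarrow> rigidity_matroid E p = M)"

definition rigidity_rank :: "'d::finite itself \<Rightarrow> 'v::finite set set \<Rightarrow> nat" where
  "rigidity_rank d E = Max (card ` generic_rigidity_matroid d E)"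

definition rigidity_linked ::
  "'d::finite itself \<Rightarrow> 'v::finite set set \<Rightarrow> 'v \<Rightarrow> 'v \<Rightarrow> bool" where
  "rigidity_linked d E u v \<longleftrightarrow> rigidity_rank d (add_edge E u v) = rigidity_rank d E"


subsection \<open>Stresses\<close>

definition stresses ::
  "'v set set \<Rightarrow> complex ^ 'd::finite ^ 'v::finite \<Rightarrow> ('v set \<Rightarrow> complex) set" where
  "stresses E p =
     {\<omega>. (\<forall>e. e \<notin> E \<longrightarrow> \<omega> e = 0) \<and>
         (\<forall>v. (\<Sum>u | {u, v} \<in> E. \<omega> {u, v} *s (p $ u - p $ v)) = 0)}"

definition one_dim_realization :: "complex ^ 'v::finite \<Rightarrow> complex ^ 1 ^ 'v" where
  "one_dim_realization q = (\<chi> w i. q $ w)"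

definition shared_stress_space ::
  "'v set set \<Rightarrow> complex ^ 'd::finite ^ 'v::finite \<Rightarrow> (complex ^ 'v) set" where
  "shared_stress_space E p = {q. stresses E p \<subseteq> stresses E (one_dim_realization q)}"

definition shared_stress_nullity :: "'d::finite itself \<Rightarrow> 'v::finite set set \<Rightarrow> nat" where
  "shared_stress_nullity (TYPE('d)) E =
     (THE k. \<forall>p :: complex ^ 'd ^ 'v. generic p \<longrightarrow> vec.dim (shared_stress_space E p) = k)"

definition stress_linked ::
  "'d::finite itself \<Rightarrow> 'v::finite set set \<Rightarrow> 'v \<Rightarrow> 'v \<Rightarrow> bool" where
  "stress_linked d E u v \<longleftrightarrow>
     rigidity_linked d E u v \<and>
     shared_stress_nullity d (add_edge E u v) = shared_stress_nullity d E"


subsection \<open>Global linkedness\<close>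

definition globally_linked ::
  "'d::finite itself \<Rightarrow> 'v::finite set set \<Rightarrow> 'v \<Rightarrow> 'v \<Rightarrow> bool" where
  "globally_linked (TYPE('d)) E u v \<longleftrightarrow>
     (\<forall>(p :: complex ^ 'd ^ 'v) (q :: complex ^ 'd ^ 'v).
        generic p \<longrightarrow> measurement E p = measurement E q \<longrightarrow> sqdist p u v = sqdist q u v)"

end

theory Submission
  imports Defs
begin

text \<open>
  Let \<open>p\<close> be generic and let \<open>q\<close> have the same edge lengths, \<open>m(p) = m(q)\<close>.

  The heart of the matter is that every stress of \<open>(G, p)\<close> is a stress of \<open>(G, q)\<close>
  (\<open>stresses_fibre\<close>), however degenerate \<open>q\<close> may be.  Up to a factor \<open>2\<close> the columns of the Jacobian
  give the equilibrium conditions that define stresses, so a stress at \<open>p\<close> is a linear relation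
  between the gradients of the functions \<open>m\<^sub>e\<close> at \<open>p\<close>.  By the Jacobian criterion
  (\<open>jacobian_criterion\<close>) the values \<open>m\<^sub>e(p)\<close> on the support of a nonzero stress satisfy a nonzero
  polynomial relation \<open>h\<close> over the rationals.  As \<open>p\<close> is generic, \<open>h\<close> vanishes on the whole image of
  \<open>m\<close>, and differentiating \<open>h(m(x)) = 0\<close> shows that the gradient of \<open>h\<close> at \<open>m(x)\<close> is a stress at
  every \<open>x\<close>.  At \<open>p\<close> and at \<open>q\<close> this gradient is the same vector, and it is nonzero if \<open>h\<close> has
  minimal degree.  Subtracting a multiple of it shrinks the support of the given stress, so by
  induction every stress at \<open>p\<close> is a stress at \<open>q\<close> (\<open>gradient_relation_persists\<close>).

  Consequently the coordinates of \<open>q\<close> lie in the shared stress space of \<open>(G, p)\<close>.  The shared stress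
  space of \<open>(G+uv, p)\<close> is contained in it and has the same dimension because \<open>{u,v}\<close> is
  stress-linked, so the two spaces agree.  Hence every stress of \<open>(G+uv, p)\<close> is a stress of
  \<open>(G+uv, q)\<close> as well.  If \<open>uv\<close> is not an edge, rigidity-linkedness provides a stress \<open>\<omega>\<close> of
  \<open>(G+uv, p)\<close> with \<open>\<omega>\<^sub>u\<^sub>v \<noteq> 0\<close> (\<open>linked_imp_stress\<close>).  Every stress of a framework satisfies
  \<open>\<Sum>\<^sub>e \<omega>\<^sub>e m\<^sub>e = 0\<close> (\<open>stress_energy_zero\<close>).  Evaluated at \<open>p\<close> and at \<open>q\<close> this
  expresses \<open>m\<^sub>u\<^sub>v\<close> by the lengths of the edges of \<open>G\<close> in the same way, so
  \<open>m\<^sub>u\<^sub>v(p) = m\<^sub>u\<^sub>v(q)\<close>.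

  The rank and the shared stress nullity of \<open>G\<close> are defined as the value common to all generic
  realizations.  That there is such a common value follows from a fraction-free Gaussian elimination
  (\<open>polynomial_linear_system\<close>): a homogeneous linear system whose coefficients are
  polynomials over the rationals has a single polynomial family of solutions that is a basis at every generic point.
\<close>

section \<open>Polynomial functions with rational coefficients\<close>

text \<open>
  Polynomials occur only through their values, so they are represented by functions: \<open>rat_poly V n f\<close>
  says that \<open>f\<close> is given by a polynomial with rational coefficients of total degree at most \<open>n\<close> in the
  variables \<open>V\<close>.  The degree bound makes it possible to choose relations of minimal degree.
\<close>

inductive rat_poly :: "'k set \<Rightarrow> nat \<Rightarrow> (('k \<Rightarrow> complex) \<Rightarrow> complex) \<Rightarrow> bool" for V where
  const: "rat_poly V n (\<lambda>_. of_rat c)"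
| var: "k \<in> V \<Longrightarrow> rat_poly V (Suc n) (\<lambda>z. z k)"
| add: "rat_poly V n f \<Longrightarrow> rat_poly V n g \<Longrightarrow> rat_poly V n (\<lambda>z. f z + g z)"
| mult: "rat_poly V m f \<Longrightarrow> rat_poly V n g \<Longrightarrow> rat_poly V (m + n) (\<lambda>z. f z * g z)"

lemma rat_poly_mono_degree:
  assumes "rat_poly V m f" and "m \<le> n"
  shows "rat_poly V n f"
  using assms
proof (induction arbitrary: n rule: rat_poly.induct)
  case (var k m)
  then show ?case by (metis Suc_le_D rat_poly.var)
next
  case (mult m f l g)
  then have "rat_poly V (m + (n - m)) (\<lambda>z. f z * g z)"
    by (intro rat_poly.mult) auto
  with mult show ?case by simp
qed (auto intro: rat_poly.intros)

lemma rat_poly_cong: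
  assumes "rat_poly V n f" and "\<And>k. k \<in> V \<Longrightarrow> y k = z k"
  shows "f y = f z"
  using assms by induction auto

lemma rat_poly_degree_0_const:
  assumes "rat_poly V n f" and "n = 0"
  shows "f y = f z"
  using assms proof induction
  case (mult m f n g)
  then show ?case by simp
qed simp_all

lemma rat_poly_subst:
  assumes "rat_poly V n h" and "\<And>k. k \<in> V \<Longrightarrow> rat_poly W d (F k)"
  shows "rat_poly W (n * d) (\<lambda>z. h (\<lambda>k. F k z))"
  using assms
proof induction
  case (var k n)
  then have "rat_poly W d (F k)" by blast
  then show ?case by (rule rat_poly_mono_degree) simp
next
  case (mult m f n g)
  then show ?case by (auto simp: distrib_right intro!: rat_poly.mult)
qed (auto intro: rat_poly.intros)

text \<open>
  The partial derivatives \<open>dh\<close> of \<open>h\<close> are characterized by the chain rule along arbitrary curves in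
  the variables \<open>V\<close>.  This covers the gradients of composite maps and the restriction of \<open>h\<close> to a
  line at the same time.
\<close>

definition has_partials ::
  "'k set \<Rightarrow> (('k \<Rightarrow> complex) \<Rightarrow> complex) \<Rightarrow> ('k \<Rightarrow> ('k \<Rightarrow> complex) \<Rightarrow> complex) \<Rightarrow> bool" where
  "has_partials V h dh \<longleftrightarrow>
     (\<forall>\<gamma> \<gamma>' t. (\<forall>k\<in>V. (\<gamma> k has_field_derivative \<gamma>' k) (at t)) \<longrightarrow>
        ((\<lambda>s. h (\<lambda>k. \<gamma> k s)) has_field_derivative
           (\<Sum>k\<in>V. dh k (\<lambda>k. \<gamma> k t) * \<gamma>' k)) (at t))"

lemma has_partialsD:
  assumes "has_partials V h dh" and "\<And>k. k \<in> V \<Longrightarrow> (\<gamma> k has_field_derivative \<gamma>' k) (at t)"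
  shows "((\<lambda>s. h (\<lambda>k. \<gamma> k s)) has_field_derivative (\<Sum>k\<in>V. dh k (\<lambda>k. \<gamma> k t) * \<gamma>' k)) (at t)"
  using assms unfolding has_partials_def by blast

lemma has_partials_const: "has_partials V (\<lambda>_. c) (\<lambda>_ _. 0)"
  by (simp add: has_partials_def)

lemma has_partials_add:
  assumes "has_partials V f df" and "has_partials V g dg"
  shows "has_partials V (\<lambda>z. f z + g z) (\<lambda>k z. df k z + dg k z)"
  using assms by (simp add: has_partials_def distrib_right sum.distrib DERIV_add)

lemma has_partials_mult:
  assumes "has_partials V f df" and "has_partials V g dg"
  shows "has_partials V (\<lambda>z. f z * g z) (\<lambda>k z. df k z * g z + f z * dg k z)"
  unfolding has_partials_def
proof (intro allI impI)
  fix \<gamma> \<gamma>' and t :: complex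
  assume \<gamma>: "\<forall>k\<in>V. (\<gamma> k has_field_derivative \<gamma>' k) (at t)"
  then have "((\<lambda>s. f (\<lambda>k. \<gamma> k s)) has_field_derivative (\<Sum>k\<in>V. df k (\<lambda>k. \<gamma> k t) * \<gamma>' k)) (at t)"
    "((\<lambda>s. g (\<lambda>k. \<gamma> k s)) has_field_derivative (\<Sum>k\<in>V. dg k (\<lambda>k. \<gamma> k t) * \<gamma>' k)) (at t)"
    using assms by (auto intro: has_partialsD)
  note DERIV_mult[OF this]
  then show "((\<lambda>s. f (\<lambda>k. \<gamma> k s) * g (\<lambda>k. \<gamma> k s)) has_field_derivative
      (\<Sum>k\<in>V. (df k (\<lambda>k. \<gamma> k t) * g (\<lambda>k. \<gamma> k t) + f (\<lambda>k. \<gamma> k t) * dg k (\<lambda>k. \<gamma> k t)) * \<gamma>' k)) (at t)"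
    by (rule DERIV_cong) (simp add: algebra_simps sum.distrib sum_distrib_left)
qed

text \<open>
  The degree drops by one.  This is what turns minimality of the degree of a relation into
  information about its gradient.
\<close>

lemma rat_poly_has_partials:
  assumes "rat_poly V n h" and "finite V"
  shows "\<exists>dh. (\<forall>k. rat_poly V (n - 1) (dh k)) \<and> has_partials V h dh"
  using assms
proof induction
  case (const n c)
  show ?case
    using rat_poly.const[of V _ 0] has_partials_const by (intro exI[of _ "\<lambda>_ _. 0"]) auto
next
  case (var k n)
  have D: "(\<Sum>j\<in>V. (if j = k then 1 else 0) * a j) = a k" for a :: "'a \<Rightarrow> complex"
    using var by (simp add: if_distrib[of "\<lambda>b. b * _"] cong: if_cong)
  have "rat_poly V n (\<lambda>_. if j = k then 1 else 0)" for j
    using rat_poly.const[of V n 1] rat_poly.const[of V n 0] by auto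
  with var D show ?case
    by (intro exI[of _ "\<lambda>j _. if j = k then 1 else 0"]) (simp add: has_partials_def)
next
  case (add n f g)
  then obtain df dg where
      "\<forall>k. rat_poly V (n - 1) (df k)" "\<forall>k. rat_poly V (n - 1) (dg k)"
    and "has_partials V f df" "has_partials V g dg"
    by blast
  then show ?case
    by (intro exI[of _ "\<lambda>k z. df k z + dg k z"]) (simp add: has_partials_add rat_poly.add)
next
  case (mult m f n g)
  have zero: "rat_poly V l (\<lambda>_. 0)" for l
    using rat_poly.const[of V l 0] by simp
  \<comment> \<open>A factor of degree \<open>0\<close> is constant, and its partials must then be chosen to be \<open>0\<close>:
    multiplied with the other factor, any other choice could exceed the degree bound.\<close>
  have partials: "\<exists>dh'. (m' = 0 \<longrightarrow> dh' = (\<lambda>_ _. 0)) \<and> (\<forall>k. rat_poly V (m' - 1) (dh' k)) \<and>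
      has_partials V h dh'"
    if "rat_poly V m' h" "\<exists>dh. (\<forall>k. rat_poly V (m' - 1) (dh k)) \<and> has_partials V h dh" for m' h
  proof (cases "m' = 0")
    case True
    have "h = (\<lambda>_. h (\<lambda>_. 0))"
      using rat_poly_degree_0_const[OF that(1) True] by blast
    then have "has_partials V h (\<lambda>_ _. 0)"
      by (metis has_partials_const)
    with zero show ?thesis by blast
  qed (use that in blast)
  obtain df where df: "m = 0 \<Longrightarrow> df = (\<lambda>_ _. 0)" "\<And>k. rat_poly V (m - 1) (df k)" "has_partials V f df"
    using partials[OF mult.hyps(1)] mult by blast
  obtain dg where dg: "n = 0 \<Longrightarrow> dg = (\<lambda>_ _. 0)" "\<And>k. rat_poly V (n - 1) (dg k)" "has_partials V g dg"
    using partials[OF mult.hyps(2)] mult by blast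
  have "rat_poly V (m + n - 1) (\<lambda>z. df k z * g z)" for k
  proof (cases "m = 0")
    case False
    then have "m - 1 + n = m + n - 1" by simp
    with rat_poly.mult[OF df(2) mult.hyps(2)] show ?thesis by metis
  qed (simp add: df(1) zero)
  moreover have "rat_poly V (m + n - 1) (\<lambda>z. f z * dg k z)" for k
  proof (cases "n = 0")
    case False
    then have "m + (n - 1) = m + n - 1" by simp
    with rat_poly.mult[OF mult.hyps(1) dg(2)] show ?thesis by metis
  qed (simp add: dg(1) zero)
  ultimately show ?case
    using has_partials_mult[OF df(3) dg(3)]
    by (intro exI[of _ "\<lambda>k z. df k z * g z + f z * dg k z"]) (simp add: rat_poly.add)
qed

lemma rat_poly_sum:
  assumes "\<And>i. i \<in> I \<Longrightarrow> rat_poly V n (f i)"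
  shows "rat_poly V n (\<lambda>z. \<Sum>i\<in>I. f i z)"
  using assms
proof (induction I rule: infinite_finite_induct)
  case (insert i I)
  then show ?case by (simp add: rat_poly.add)
qed (use rat_poly.const[of V n 0] in simp_all)

lemma rat_poly_power:
  assumes "rat_poly V n f"
  shows "rat_poly V (m * n) (\<lambda>z. f z ^ m)"
proof (induction m)
  case 0
  show ?case using rat_poly.const[of V 0 1] by simp
next
  case (Suc m)
  show ?case using rat_poly.mult[OF assms Suc] by simp
qed

lemma rat_poly_prod:
  assumes "\<And>i. i \<in> I \<Longrightarrow> rat_poly V n (f i)" and "finite I"
  shows "rat_poly V (card I * n) (\<lambda>z. \<Prod>i\<in>I. f i z)"
  using assms(2,1)
proof (induction I)
  case empty
  show ?case using rat_poly.const[of V 0 1] by simp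
next
  case (insert i I)
  then have "rat_poly V (n + card I * n) (\<lambda>z. f i z * (\<Prod>i\<in>I. f i z))"
    by (intro rat_poly.mult) auto
  with insert show ?case by simp
qed

section \<open>Generic points\<close>

abbreviation monomial :: "('x::finite \<Rightarrow>\<^sub>0 nat) \<Rightarrow> ('x \<Rightarrow> complex) \<Rightarrow> complex" where
  "monomial m x \<equiv> (\<Prod>j\<in>UNIV. x j ^ Poly_Mapping.lookup m j)"

text \<open>
  Summing over a fixed finite set of exponents, with zero coefficients allowed, makes the additive
  behaviour of the evaluation visible.
\<close>

lemma mpoly_eval_superset:
  fixes P :: "('x::finite \<Rightarrow>\<^sub>0 nat) \<Rightarrow>\<^sub>0 rat"
  assumes "finite S" and "Poly_Mapping.keys P \<subseteq> S"
  shows "mpoly_eval P x = (\<Sum>m\<in>S. of_rat (Poly_Mapping.lookup P m) * monomial m x)"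
proof -
  have "(\<Prod>j\<in>Poly_Mapping.keys m. x j ^ Poly_Mapping.lookup m j) = monomial m x" for m :: "'x \<Rightarrow>\<^sub>0 nat"
    by (rule prod.mono_neutral_left) (auto simp: in_keys_iff)
  then have "mpoly_eval P x = (\<Sum>m\<in>Poly_Mapping.keys P. of_rat (Poly_Mapping.lookup P m) * monomial m x)"
    by (simp add: mpoly_eval_def)
  also have "\<dots> = (\<Sum>m\<in>S. of_rat (Poly_Mapping.lookup P m) * monomial m x)"
    using assms by (intro sum.mono_neutral_left) (auto simp: in_keys_iff)
  finally show ?thesis .
qed

lemma mpoly_eval_single:
  fixes m :: "'x::finite \<Rightarrow>\<^sub>0 nat"
  shows "mpoly_eval (Poly_Mapping.single m c) x = of_rat c * monomial m x"
  by (subst mpoly_eval_superset[of "{m}"]) auto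

lemma mpoly_eval_add:
  fixes P Q :: "('x::finite \<Rightarrow>\<^sub>0 nat) \<Rightarrow>\<^sub>0 rat"
  shows "mpoly_eval (P + Q) x = mpoly_eval P x + mpoly_eval Q x"
proof -
  let ?S = "Poly_Mapping.keys P \<union> Poly_Mapping.keys Q"
  have "Poly_Mapping.keys (P + Q) \<subseteq> ?S" by (rule keys_add)
  then show ?thesis
    by (simp add: mpoly_eval_superset[of ?S] lookup_add of_rat_add distrib_right sum.distrib)
qed

lemma mpoly_eval_sum:
  fixes P :: "'i \<Rightarrow> ('x::finite \<Rightarrow>\<^sub>0 nat) \<Rightarrow>\<^sub>0 rat"
  shows "mpoly_eval (sum P I) x = (\<Sum>i\<in>I. mpoly_eval (P i) x)"
  by (induction I rule: infinite_finite_induct) (simp_all add: mpoly_eval_add, auto simp: mpoly_eval_def)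

lemma sum_single_lookup:
  fixes P :: "'a \<Rightarrow>\<^sub>0 'b::comm_monoid_add"
  shows "(\<Sum>m\<in>Poly_Mapping.keys P. Poly_Mapping.single m (Poly_Mapping.lookup P m)) = P"
  by (rule poly_mapping_eqI) (auto simp: lookup_sum lookup_single when_def in_keys_iff)

lemma mpoly_eval_mult:
  fixes P Q :: "('x::finite \<Rightarrow>\<^sub>0 nat) \<Rightarrow>\<^sub>0 rat"
  shows "mpoly_eval (P * Q) x = mpoly_eval P x * mpoly_eval Q x"
proof -
  let ?p = "Poly_Mapping.lookup P" and ?q = "Poly_Mapping.lookup Q"
  have "P * Q = (\<Sum>m\<in>Poly_Mapping.keys P. \<Sum>l\<in>Poly_Mapping.keys Q.
      Poly_Mapping.single m (?p m) * Poly_Mapping.single l (?q l))"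
    by (simp only: sum_product[symmetric] sum_single_lookup)
  then have "mpoly_eval (P * Q) x = (\<Sum>m\<in>Poly_Mapping.keys P. \<Sum>l\<in>Poly_Mapping.keys Q.
      (of_rat (?p m) * monomial m x) * (of_rat (?q l) * monomial l x))"
    by (simp add: mpoly_eval_sum mult_single mpoly_eval_single lookup_add power_add
        prod.distrib of_rat_mult mult_ac)
  also have "\<dots> = mpoly_eval P x * mpoly_eval Q x"
    by (simp only: sum_product[symmetric]) (simp add: mpoly_eval_superset[OF finite_keys subset_refl])
  finally show ?thesis .
qed

definition exponent_box :: "nat \<Rightarrow> ('x::finite \<Rightarrow>\<^sub>0 nat) set" where
  "exponent_box n = {m. \<forall>j. Poly_Mapping.lookup m j \<le> n}"

lemma exponent_box_finite_card:
  "finite (exponent_box n :: ('x::finite \<Rightarrow>\<^sub>0 nat) set)"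
  "card (exponent_box n :: ('x::finite \<Rightarrow>\<^sub>0 nat) set) \<le> (n + 1) ^ CARD('x)"
proof -
  let ?B = "exponent_box n :: ('x \<Rightarrow>\<^sub>0 nat) set" and ?F = "PiE (UNIV :: 'x set) (\<lambda>_. {..n})"
  have inj: "inj_on Poly_Mapping.lookup ?B" by (simp add: inj_on_def lookup_inject)
  have sub: "Poly_Mapping.lookup ` ?B \<subseteq> ?F" by (auto simp: exponent_box_def)
  have fin: "finite ?F" by (simp add: finite_PiE)
  show "finite ?B" using inj sub fin by (meson finite_imageD finite_subset)
  have "card ?B \<le> card ?F" using inj sub fin by (rule card_inj_on_le)
  then show "card ?B \<le> (n + 1) ^ CARD('x)" by (simp add: card_PiE)
qed

text \<open>
  The bound on the exponents is needed for counting: it confines all polynomials of bounded degree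
  to a space over \<open>\<rat>\<close> of controlled dimension.
\<close>

lemma rat_poly_imp_mpoly_eval:
  fixes f :: "('x::finite \<Rightarrow> complex) \<Rightarrow> complex"
  assumes "rat_poly UNIV n f"
  shows "\<exists>P. Poly_Mapping.keys P \<subseteq> exponent_box n \<and> f = mpoly_eval P"
  using assms
proof induction
  case (const n c)
  show ?case
    by (rule exI[of _ "Poly_Mapping.single 0 c"]) (auto simp: exponent_box_def mpoly_eval_single)
next
  case (var k n)
  have "monomial (Poly_Mapping.single k 1) z = z k" for z
  proof -
    have "monomial (Poly_Mapping.single k 1) z = (\<Prod>j\<in>UNIV. if j = k then z j else 1)"
      by (rule prod.cong) (auto simp: lookup_single when_def)
    then show ?thesis by simp
  qed
  then show ?case
    by (intro exI[of _ "Poly_Mapping.single (Poly_Mapping.single k 1) 1"])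
       (auto simp: exponent_box_def mpoly_eval_single lookup_single when_def)
next
  case (add n f g)
  then obtain P Q where "Poly_Mapping.keys P \<subseteq> exponent_box n" "f = mpoly_eval P"
    "Poly_Mapping.keys Q \<subseteq> exponent_box n" "g = mpoly_eval Q" by blast
  then show ?case
    using keys_add[of P Q] by (intro exI[of _ "P + Q"]) (auto simp: mpoly_eval_add)
next
  case (mult m f n g)
  then obtain P Q where "Poly_Mapping.keys P \<subseteq> exponent_box m" "f = mpoly_eval P"
    "Poly_Mapping.keys Q \<subseteq> exponent_box n" "g = mpoly_eval Q" by blast
  then show ?case
    using keys_mult[of P Q] by (intro exI[of _ "P * Q"])
     (fastforce simp: mpoly_eval_mult exponent_box_def lookup_add intro!: add_mono)
qed

text \<open>
  Stated for functions instead of formal polynomials, genericity is exactly the principle by which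
  identities are proved below: a polynomial equation over \<open>\<rat>\<close> that holds at one generic point holds
  everywhere.
\<close>

definition generic_point :: "('x \<Rightarrow> complex) \<Rightarrow> bool" where
  "generic_point x \<longleftrightarrow> (\<forall>n f. rat_poly UNIV n f \<longrightarrow> f x = 0 \<longrightarrow> f = (\<lambda>_. 0))"

lemma generic_imp_generic_point:
  fixes p :: "complex ^ 'd::finite ^ 'v::finite"
  assumes "generic p"
  shows "generic_point (\<lambda>(w, i). p $ w $ i)"
  unfolding generic_point_def
proof (intro allI impI)
  fix n and f :: "('v \<times> 'd \<Rightarrow> complex) \<Rightarrow> complex"
  assume "rat_poly UNIV n f" and zero: "f (\<lambda>(w, i). p $ w $ i) = 0"
  then obtain P where P: "f = mpoly_eval P" using rat_poly_imp_mpoly_eval by blast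
  with zero assms have "P = 0" unfolding generic_def by blast
  with P show "f = (\<lambda>_. 0)" by (auto simp: mpoly_eval_def)
qed

section \<open>Algebraic dependence\<close>

text \<open>
  A family with a repetition has the obvious relation between the two equal members, so triviality
  of all relations captures injectivity together with independence of the image.
\<close>

lemma (in vector_space) independent_family_iff:
  assumes "finite I"
  shows "inj_on v I \<and> independent (v ` I) \<longleftrightarrow>
    (\<forall>c. (\<Sum>i\<in>I. scale (c i) (v i)) = 0 \<longrightarrow> (\<forall>i\<in>I. c i = 0))"
proof (intro iffI allI impI ballI)
  fix c i
  assume v: "inj_on v I \<and> independent (v ` I)"
    and zero: "(\<Sum>i\<in>I. scale (c i) (v i)) = 0" and "i \<in> I"
  let ?u = "\<lambda>w. c (the_inv_into I v w)"
  have "(\<Sum>w\<in>v ` I. scale (?u w) w) = (\<Sum>i\<in>I. scale (c i) (v i))"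
    using v by (simp add: sum.reindex the_inv_into_f_f)
  then have "\<forall>w\<in>v ` I. ?u w = 0"
    using v zero assms dependent_finite[of "v ` I"] by auto
  then show "c i = 0"
    using v \<open>i \<in> I\<close> by (auto simp: the_inv_into_f_f)
next
  assume triv: "\<forall>c. (\<Sum>i\<in>I. scale (c i) (v i)) = 0 \<longrightarrow> (\<forall>i\<in>I. c i = 0)"
  have inj: "inj_on v I"
  proof (rule inj_onI, rule ccontr)
    fix i j assume ij: "i \<in> I" "j \<in> I" "v i = v j" "i \<noteq> j"
    let ?c = "\<lambda>k. (if k = i then 1 else 0) - (if k = j then 1 else 0 :: 'a)"
    have delta: "(\<Sum>k\<in>I. scale (if k = l then 1 else 0) (v k)) = v l" if "l \<in> I" for l
      using assms that by (simp add: if_distrib[of "\<lambda>b. scale b _"] cong: if_cong)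
    have "(\<Sum>k\<in>I. scale (?c k) (v k)) = 0"
      using ij by (simp only: scale_left_diff_distrib sum_subtractf delta) simp
    then have "\<forall>k\<in>I. ?c k = 0" by (rule mp[OF spec[OF triv, of ?c]])
    then have "?c i = 0" using ij by blast
    with ij show False by simp
  qed
  moreover have "independent (v ` I)"
  proof
    assume "dependent (v ` I)"
    then obtain u where u: "\<exists>w\<in>v ` I. u w \<noteq> 0" "(\<Sum>w\<in>v ` I. scale (u w) w) = 0"
      using assms dependent_finite[of "v ` I"] by auto
    then have "(\<Sum>i\<in>I. scale (u (v i)) (v i)) = 0"
      using inj by (simp add: sum.reindex)
    then have "\<forall>i\<in>I. u (v i) = 0" by (rule mp[OF spec[OF triv, of "\<lambda>i. u (v i)"]])
    with u(1) show False by blast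
  qed
  ultimately show "inj_on v I \<and> independent (v ` I)" ..
qed

text \<open>
  Induction on the variables: with all other variables fixed, the sum is a polynomial in the
  remaining one that vanishes identically, so its coefficients vanish, and these are sums of the same
  kind in fewer variables.
\<close>

lemma monomials_independent:
  fixes c :: "('k \<Rightarrow> nat) \<Rightarrow> complex"
  assumes "finite K"
    and "\<And>z. (\<Sum>\<beta>\<in>PiE K (\<lambda>_. {..<M}). c \<beta> * (\<Prod>k\<in>K. z k ^ \<beta> k)) = 0"
    and "\<beta> \<in> PiE K (\<lambda>_. {..<M})"
  shows "c \<beta> = 0"
  using assms
proof (induction K arbitrary: c \<beta> rule: finite_induct)
  case empty
  then show ?case by simp
next
  case (insert l K)
  let ?B = "PiE K (\<lambda>_. {..<M})"
  have finB: "finite ?B" using insert.hyps by (simp add: finite_PiE)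
  have "(\<Sum>\<alpha>\<in>?B. c (\<alpha>(l := n)) * (\<Prod>k\<in>K. z k ^ \<alpha> k)) = 0" if "n < M" for n and z :: "'k \<Rightarrow> complex"
  proof -
    have "(\<Sum>n\<le>M-1. (\<Sum>\<alpha>\<in>?B. c (\<alpha>(l := n)) * (\<Prod>k\<in>K. z k ^ \<alpha> k)) * t ^ n) = 0" for t
    proof -
      have prod: "(\<Prod>k\<in>insert l K. (z(l := t)) k ^ (\<alpha>(l := n)) k) = t ^ n * (\<Prod>k\<in>K. z k ^ \<alpha> k)" for n \<alpha>
      proof -
        have "(\<Prod>k\<in>K. (z(l := t)) k ^ (\<alpha>(l := n)) k) = (\<Prod>k\<in>K. z k ^ \<alpha> k)"
          using insert.hyps by (intro prod.cong) auto
        then show ?thesis using insert.hyps by simp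
      qed
      have inj: "inj_on (\<lambda>(n, \<alpha>). \<alpha>(l := n)) ({..<M} \<times> ?B)"
        using inj_combinator[OF insert.hyps(2), of "\<lambda>_. {..<M}"] by simp
      have "0 = (\<Sum>\<beta>\<in>(\<lambda>(n, \<alpha>). \<alpha>(l := n)) ` ({..<M} \<times> ?B). c \<beta> * (\<Prod>k\<in>insert l K. (z(l := t)) k ^ \<beta> k))"
        using insert.prems(1)[of "z(l := t)"] by (simp only: PiE_insert_eq)
      also have "\<dots> = (\<Sum>(n, \<alpha>)\<in>{..<M} \<times> ?B. c (\<alpha>(l := n)) * (t ^ n * (\<Prod>k\<in>K. z k ^ \<alpha> k)))"
        unfolding sum.reindex[OF inj] by (intro sum.cong) (simp_all only: o_def split_beta prod)
      also have "\<dots> = (\<Sum>n<M. \<Sum>\<alpha>\<in>?B. c (\<alpha>(l := n)) * (t ^ n * (\<Prod>k\<in>K. z k ^ \<alpha> k)))"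
        using finB by (simp add: sum.cartesian_product)
      finally have "(\<Sum>n<M. \<Sum>\<alpha>\<in>?B. c (\<alpha>(l := n)) * (t ^ n * (\<Prod>k\<in>K. z k ^ \<alpha> k))) = 0" by simp
      moreover have "{..M-1} = {..<M}" using that by auto
      ultimately show ?thesis by (simp only: sum_distrib_left sum_distrib_right mult_ac)
    qed
    then have "\<forall>n\<le>M-1. (\<Sum>\<alpha>\<in>?B. c (\<alpha>(l := n)) * (\<Prod>k\<in>K. z k ^ \<alpha> k)) = 0"
      unfolding polyfun_eq_0[symmetric] by blast
    with that show ?thesis by simp
  qed
  note IH = insert.IH[of "\<lambda>\<alpha>. c (\<alpha>(l := n))" for n, OF this]
  obtain n \<alpha> where "n < M" "\<alpha> \<in> ?B" "\<beta> = \<alpha>(l := n)"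
    using insert.prems(2) by (auto simp: PiE_insert_eq)
  with IH show ?case by blast
qed

definition algebraically_dependent :: "'k set \<Rightarrow> ('k \<Rightarrow> complex) \<Rightarrow> bool" where
  "algebraically_dependent K y \<longleftrightarrow> (\<exists>n h. rat_poly K n h \<and> h \<noteq> (\<lambda>_. 0) \<and> h y = 0)"

text \<open>
  A dimension count.  There are \<open>M ^ card K\<close> monomials in the \<open>F k\<close> with all exponents below \<open>M\<close>.
  Their values lie in the \<open>\<rat>\<close>-span of the values of the monomials in \<open>x\<close> with exponents bounded by a
  multiple of \<open>M\<close>, and the number of the latter grows only like \<open>M ^ CARD('x)\<close>.  For large \<open>M\<close> this
  forces a linear relation over \<open>\<rat>\<close>, which is a polynomial relation between the \<open>F k\<close>.
\<close>

lemma algebraically_dependent_if_card_gt: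
  fixes F :: "'k \<Rightarrow> ('x::finite \<Rightarrow> complex) \<Rightarrow> complex"
  assumes K: "finite K" "card K > CARD('x)"
    and F: "\<And>k. k \<in> K \<Longrightarrow> rat_poly UNIV d (F k)"
  shows "algebraically_dependent K (\<lambda>k. F k x)"
proof -
  interpret Q: vector_space "\<lambda>(r::rat) (z::complex). of_rat r * z"
    by unfold_locales (simp_all add: of_rat_add of_rat_mult algebra_simps)
  \<comment> \<open>Chosen such that the count of the monomials in the \<open>F k\<close> wins.\<close>
  define M where "M = (d * card K + 1) ^ CARD('x) + 1"
  define I where "I = PiE K (\<lambda>_. {..<M})"
  define v where "v = (\<lambda>\<beta>. \<Prod>k\<in>K. F k x ^ \<beta> k)"
  define T where "T = (\<lambda>m. monomial m x) ` exponent_box (card K * (M * d))"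
  have finI: "finite I" and cardI: "card I = M ^ card K"
    using K by (simp_all add: I_def finite_PiE card_PiE)
  have "card T \<le> card (exponent_box (card K * (M * d)) :: ('x \<Rightarrow>\<^sub>0 nat) set)"
    unfolding T_def by (rule card_image_le[OF exponent_box_finite_card(1)])
  also have "\<dots> \<le> (card K * (M * d) + 1) ^ CARD('x)"
    by (rule exponent_box_finite_card(2))
  also have "\<dots> \<le> ((d * card K + 1) * M) ^ CARD('x)"
    by (intro power_mono) (simp_all add: M_def algebra_simps)
  also have "\<dots> = (d * card K + 1) ^ CARD('x) * M ^ CARD('x)"
    by (rule power_mult_distrib)
  also have "\<dots> < M * M ^ CARD('x)"
    by (rule mult_strict_right_mono) (simp_all add: M_def)
  also have "\<dots> \<le> M ^ card K"
    using K(2) by (metis M_def Suc_leI le_add2 power_Suc power_increasing)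
  finally have card: "card T < card I" using cardI by simp
  have finT: "finite T" by (simp add: T_def exponent_box_finite_card)
  have "v \<beta> \<in> Q.span T" if "\<beta> \<in> I" for \<beta>
  proof -
    have "rat_poly UNIV (M * d) (\<lambda>x. F k x ^ \<beta> k)" if "k \<in> K" for k
      using \<open>\<beta> \<in> I\<close> that
      by (intro rat_poly_mono_degree[OF rat_poly_power[OF F[OF that]]])
         (auto simp: I_def PiE_iff intro!: mult_right_mono less_imp_le)
    then have "rat_poly UNIV (card K * (M * d)) (\<lambda>x. \<Prod>k\<in>K. F k x ^ \<beta> k)"
      using K by (intro rat_poly_prod) auto
    then obtain P where P: "Poly_Mapping.keys P \<subseteq> exponent_box (card K * (M * d))"
      and eval: "(\<lambda>x. \<Prod>k\<in>K. F k x ^ \<beta> k) = mpoly_eval P"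
      using rat_poly_imp_mpoly_eval by blast
    have "v \<beta> = mpoly_eval P x" using fun_cong[OF eval, of x] by (simp add: v_def)
    also have "\<dots> = (\<Sum>m\<in>exponent_box (card K * (M * d)). of_rat (Poly_Mapping.lookup P m) * monomial m x)"
      by (rule mpoly_eval_superset[OF exponent_box_finite_card(1) P])
    also have "\<dots> \<in> Q.span T"
      by (intro Q.span_sum Q.span_scale Q.span_base) (auto simp: T_def)
    finally show ?thesis .
  qed
  then have "v ` I \<subseteq> Q.span T" by blast
  have "\<not> (inj_on v I \<and> Q.independent (v ` I))"
  proof
    assume v: "inj_on v I \<and> Q.independent (v ` I)"
    then have "card (v ` I) \<le> card T"
      using Q.independent_span_bound[OF finT] \<open>v ` I \<subseteq> Q.span T\<close> by blast
    with v card show False by (simp add: card_image)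
  qed
  then obtain c \<beta> where c: "(\<Sum>\<beta>\<in>I. of_rat (c \<beta>) * v \<beta>) = 0" and \<beta>: "\<beta> \<in> I" "c \<beta> \<noteq> 0"
    unfolding Q.independent_family_iff[OF finI] by blast
  define h :: "('k \<Rightarrow> complex) \<Rightarrow> complex" where "h = (\<lambda>z. \<Sum>\<beta>\<in>I. of_rat (c \<beta>) * (\<Prod>k\<in>K. z k ^ \<beta> k))"
  have "rat_poly K (0 + card K * (M * 1)) h"
    unfolding h_def
  proof (intro rat_poly_sum rat_poly.mult rat_poly.const rat_poly_prod K(1))
    fix \<beta> k assume "\<beta> \<in> I" "k \<in> K"
    then have "\<beta> k \<le> M" by (auto simp: I_def PiE_iff intro: less_imp_le)
    moreover have "rat_poly K (\<beta> k * Suc 0) (\<lambda>z. z k ^ \<beta> k)"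
      using \<open>k \<in> K\<close> by (intro rat_poly_power rat_poly.var)
    ultimately show "rat_poly K (M * 1) (\<lambda>z. z k ^ \<beta> k)"
      by (auto intro: rat_poly_mono_degree)
  qed
  moreover have "h \<noteq> (\<lambda>_. 0)"
  proof
    assume "h = (\<lambda>_. 0)"
    then have "(\<Sum>\<beta>\<in>I. of_rat (c \<beta>) * (\<Prod>k\<in>K. z k ^ \<beta> k)) = 0" for z :: "'k \<Rightarrow> complex"
      unfolding h_def by meson
    then have "of_rat (c \<beta>) = (0 :: complex)"
      using monomials_independent[OF K(1), where c = "\<lambda>\<beta>. of_rat (c \<beta>)" and M = M] \<beta>(1) unfolding I_def by blast
    with \<beta>(2) show False by simp
  qed
  moreover have "h (\<lambda>k. F k x) = 0"
    using c by (simp add: h_def v_def)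
  ultimately show ?thesis unfolding algebraically_dependent_def by blast
qed

section \<open>Algebraic dependence and gradients\<close>

text \<open>
  For a relation \<open>h\<close> of least degree, a partial derivative that vanishes at \<open>y\<close> would be a relation of
  smaller degree, so it is zero identically.
\<close>

lemma minimal_relation:
  assumes "finite L" and "algebraically_dependent L y"
  shows "\<exists>n h dh. rat_poly L n h \<and> h \<noteq> (\<lambda>_. 0) \<and> h y = 0 \<and> (\<forall>l. rat_poly L (n - 1) (dh l)) \<and>
    has_partials L h dh \<and> (\<forall>l. dh l y = 0 \<longrightarrow> dh l = (\<lambda>_. 0))"
proof -
  define R where "R = (\<lambda>n. \<exists>h. rat_poly L n h \<and> h \<noteq> (\<lambda>_. 0) \<and> h y = 0)"
  define n where "n = (LEAST n. R n)"
  have "\<exists>n. R n" using assms(2) by (simp add: R_def algebraically_dependent_def)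
  then have "R n" unfolding n_def by (rule LeastI_ex)
  then obtain h where h: "rat_poly L n h" "h \<noteq> (\<lambda>_. 0)" "h y = 0"
    unfolding R_def by blast
  obtain dh where dh: "\<forall>k. rat_poly L (n - 1) (dh k)" "has_partials L h dh"
    using rat_poly_has_partials[OF h(1) assms(1)] by blast
  have "n \<noteq> 0"
  proof
    assume "n = 0"
    then have "h z = h y" for z using rat_poly_degree_0_const[OF h(1)] by blast
    with h show False by auto
  qed
  then have "\<not> R (n - 1)" unfolding n_def using not_less_Least[of "n - 1" R] by (simp add: n_def)
  then have "dh l = (\<lambda>_. 0)" if "dh l y = 0" for l
    using dh(1) that unfolding R_def by blast
  with h dh show ?thesis by blast
qed

text \<open>
  Along the segment from \<open>y\<close> to \<open>z\<close> every term of the derivative of \<open>h\<close> vanishes: either the variable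
  is constant or the partial derivative is zero.
\<close>

lemma zero_partials_imp_eq:
  assumes "has_partials V h dh"
    and "\<And>k. k \<in> V \<Longrightarrow> y k \<noteq> z k \<Longrightarrow> dh k = (\<lambda>_. 0)"
  shows "h y = h z"
proof -
  let ?\<gamma> = "\<lambda>k s. y k + s * (z k - y k)"
  have "((\<lambda>s. h (\<lambda>k. ?\<gamma> k s)) has_field_derivative 0) (at t)" for t
  proof -
    have "((\<lambda>s. h (\<lambda>k. ?\<gamma> k s)) has_field_derivative
        (\<Sum>k\<in>V. dh k (\<lambda>k. ?\<gamma> k t) * (z k - y k))) (at t)"
      by (rule has_partialsD[OF assms(1)]) (auto intro!: derivative_eq_intros)
    also have "(\<Sum>k\<in>V. dh k (\<lambda>k. ?\<gamma> k t) * (z k - y k)) = 0"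
      using assms(2) by (intro sum.neutral) (metis cancel_comm_monoid_add_class.diff_cancel mult_zero_left mult_zero_right)
    finally show ?thesis .
  qed
  then obtain c where c: "\<And>s. h (\<lambda>k. ?\<gamma> k s) = c"
    using has_field_derivative_zero_constant[of UNIV "\<lambda>s. h (\<lambda>k. ?\<gamma> k s)"] by auto
  show ?thesis using c[of 0] c[of 1] by simp
qed

text \<open>
  A relation between the values at one generic point holds identically, so it can be differentiated.
\<close>

lemma relation_gradient:
  assumes p: "generic_point p" and "finite L"
    and F: "\<And>l. l \<in> L \<Longrightarrow> rat_poly UNIV d (F l)"
    and G: "\<And>l j x. l \<in> L \<Longrightarrow> ((\<lambda>t. F l (x(j := t))) has_field_derivative G l j x) (at (x j))"
    and h: "rat_poly L n h" "h (\<lambda>l. F l p) = 0" "has_partials L h dh"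
  shows "(\<Sum>l\<in>L. dh l (\<lambda>l. F l x) * G l j x) = 0"
proof -
  have "rat_poly UNIV (n * d) (\<lambda>x. h (\<lambda>l. F l x))"
    using rat_poly_subst[OF h(1) F] .
  then have "(\<lambda>x. h (\<lambda>l. F l x)) = (\<lambda>_. 0)"
    using p h(2) unfolding generic_point_def by blast
  then have zero: "h (\<lambda>l. F l x) = 0" for x by meson
  have "((\<lambda>t. h (\<lambda>l. F l (x(j := t)))) has_field_derivative
      (\<Sum>l\<in>L. dh l (\<lambda>l. F l (x(j := x j))) * G l j x)) (at (x j))"
    by (rule has_partialsD[OF h(3) G])
  then have "((\<lambda>_. 0) has_field_derivative (\<Sum>l\<in>L. dh l (\<lambda>l. F l x) * G l j x)) (at (x j))"
    by (simp add: zero)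
  then show ?thesis using DERIV_unique DERIV_const by blast
qed

text \<open>
  The other variables do not occur in the relation, so they can be set to \<open>0\<close>.
\<close>

lemma algebraically_dependent_Inl:
  assumes "algebraically_dependent (Inl ` K) y"
  shows "algebraically_dependent K (\<lambda>k. y (Inl k))"
proof -
  obtain n h where h: "rat_poly (Inl ` K) n h" "h \<noteq> (\<lambda>_. 0)" "h y = 0"
    using assms unfolding algebraically_dependent_def by blast
  have cong: "h (case_sum (\<lambda>k. z (Inl k)) (\<lambda>_. 0)) = h z" for z
    by (rule rat_poly_cong[OF h(1)]) auto
  have eq: "(\<lambda>l. case l of Inl k \<Rightarrow> z k | Inr _ \<Rightarrow> 0) = case_sum z (\<lambda>_. 0)" for z :: "_ \<Rightarrow> complex"
    by (auto split: sum.split)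
  have "rat_poly K (n * Suc 0) (\<lambda>z. h (\<lambda>l. (case l of Inl k \<Rightarrow> (\<lambda>z. z k) | Inr _ \<Rightarrow> (\<lambda>_. 0)) z))"
    by (rule rat_poly_subst[OF h(1)]) (auto intro: rat_poly.var)
  also have "(\<lambda>z. h (\<lambda>l. (case l of Inl k \<Rightarrow> (\<lambda>z. z k) | Inr _ \<Rightarrow> (\<lambda>_. 0)) z)) = (\<lambda>z. h (case_sum z (\<lambda>_. 0)))"
    by (intro ext arg_cong[where f = h]) (auto split: sum.split)
  finally have "rat_poly K (n * Suc 0) (\<lambda>z. h (case_sum z (\<lambda>_. 0)))" .
  moreover obtain z where "h z \<noteq> 0" using h(2) by auto
  then have "(\<lambda>z. h (case_sum z (\<lambda>_. 0))) \<noteq> (\<lambda>_. 0)"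
    using cong[of z] by metis
  moreover have "h (case_sum (\<lambda>k. y (Inl k)) (\<lambda>_. 0)) = 0"
    using cong h(3) by simp
  ultimately show ?thesis unfolding algebraically_dependent_def by blast
qed

text \<open>
  A polynomial whose derivative with respect to \<open>i\<close> is zero does not change when \<open>i\<close> is set to \<open>0\<close>.
\<close>

lemma relation_eliminate_variable:
  assumes h: "rat_poly (insert i L) n h" "h \<noteq> (\<lambda>_. 0)" "h y = 0"
    and "has_partials (insert i L) h dh" and "dh i = (\<lambda>_. 0)"
  shows "algebraically_dependent L y"
proof -
  have drop: "h (z(i := 0)) = h z" for z
    by (rule zero_partials_imp_eq[OF assms(4)]) (use assms(5) in \<open>auto split: if_splits\<close>)
  have "rat_poly L (n * Suc 0) (\<lambda>z. h (\<lambda>l. (if l = i then (\<lambda>_. 0) else (\<lambda>z. z l)) z))"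
    by (rule rat_poly_subst[OF h(1)]) (use rat_poly.const[of L _ 0] in \<open>auto intro: rat_poly.var\<close>)
  also have "(\<lambda>z. h (\<lambda>l. (if l = i then (\<lambda>_. 0) else (\<lambda>z. z l)) z)) = h"
  proof
    fix z :: "_ \<Rightarrow> complex"
    have "(\<lambda>l. (if l = i then (\<lambda>_. 0) else (\<lambda>z. z l)) z) = z(i := 0)" by auto
    then show "h (\<lambda>l. (if l = i then (\<lambda>_. 0) else (\<lambda>z. z l)) z) = h z" using drop by simp
  qed
  finally show ?thesis using h unfolding algebraically_dependent_def by blast
qed

text \<open>
  In characteristic zero, algebraically independent functions have independent gradients.  The
  family is enlarged by coordinate functions to a maximal algebraically independent one, which by
  counting has at most \<open>CARD('x)\<close> members.  Each coordinate outside it satisfies a minimal relation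
  that really involves it, and the differentiated relation puts its gradient, a unit vector, into the
  span of the gradients of the family.  At most \<open>CARD('x)\<close> vectors that span the whole space are
  independent.
\<close>

lemma jacobian_criterion:
  fixes F :: "'k \<Rightarrow> ('x::finite \<Rightarrow> complex) \<Rightarrow> complex"
  assumes p: "generic_point p" and K: "finite K"
    and F: "\<And>k. k \<in> K \<Longrightarrow> rat_poly UNIV d (F k)"
    and G: "\<And>k j x. k \<in> K \<Longrightarrow> ((\<lambda>t. F k (x(j := t))) has_field_derivative G k j x) (at (x j))"
    and indep: "\<not> algebraically_dependent K (\<lambda>k. F k p)"
    and zero: "\<And>j. (\<Sum>k\<in>K. c k * G k j p) = 0" and "k \<in> K"
  shows "c k = 0"
proof -
  \<comment> \<open>The family \<open>F\<close> together with all coordinate functions of the ambient space.\<close>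
  define F' where "F' = case_sum F (\<lambda>i x. x i)"
  define G' where "G' = case_sum G (\<lambda>i j x. if i = j then 1 else 0)"
  define y where "y = (\<lambda>l. F' l p)"
  define L where "L J = Inl ` K \<union> Inr ` J" for J :: "'x set"
  define r where "r l = (\<chi> j. G' l j p)" for l
  have F': "rat_poly UNIV (Suc d) (F' l)" and
    G': "\<And>j x. ((\<lambda>t. F' l (x(j := t))) has_field_derivative G' l j x) (at (x j))"
    if "l \<in> L J" for l J
  proof -
    show "rat_poly UNIV (Suc d) (F' l)"
      using that F rat_poly.var[of _ UNIV d]
      by (auto simp: L_def F'_def intro: rat_poly_mono_degree[of _ d])
    show "((\<lambda>t. F' l (x(j := t))) has_field_derivative G' l j x) (at (x j))" for j x
      using that G by (auto simp: L_def F'_def G'_def)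
  qed
  have finL: "finite (L J)" for J using K by (simp add: L_def)
  have "\<not> algebraically_dependent (L {}) y"
    using indep algebraically_dependent_Inl[of K y] by (auto simp: L_def y_def F'_def)
  then obtain J where J: "\<not> algebraically_dependent (L J) y"
    and max: "\<And>J'. \<not> algebraically_dependent (L J') y \<Longrightarrow> J \<subseteq> J' \<Longrightarrow> J = J'"
    using finite_has_maximal[of "{J. \<not> algebraically_dependent (L J) y}"] by auto
  have card: "card (L J) \<le> CARD('x)"
  proof (rule ccontr)
    assume "\<not> card (L J) \<le> CARD('x)"
    then have "algebraically_dependent (L J) (\<lambda>l. F' l p)"
      by (intro algebraically_dependent_if_card_gt[OF finL _ F'[of _ J]]) simp_all
    with J show False by (simp add: y_def)
  qed
  have axis: "axis i 1 \<in> vec.span (r ` L J)" for i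
  proof (cases "i \<in> J")
    case True
    then have "axis i 1 = r (Inr i)" "Inr i \<in> L J"
      by (auto simp: r_def G'_def L_def axis_def vec_eq_iff)
    then show ?thesis by (metis imageI vec.span_base)
  next
    case False
    have ins: "L (insert i J) = insert (Inr i) (L J)" by (auto simp: L_def)
    have "algebraically_dependent (insert (Inr i) (L J)) y"
      using max[of "insert i J"] False ins by auto
    then obtain n h dh where h: "rat_poly (insert (Inr i) (L J)) n h" "h \<noteq> (\<lambda>_. 0)" "h y = 0"
        "has_partials (insert (Inr i) (L J)) h dh" "\<forall>l. dh l y = 0 \<longrightarrow> dh l = (\<lambda>_. 0)"
      using minimal_relation[of "insert (Inr i) (L J)" y] finL[of J] by auto
    have nz: "dh (Inr i) y \<noteq> 0"
      using relation_eliminate_variable[OF h(1-4)] h(5) J by blast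
    have "Inr i \<notin> L J" using False by (auto simp: L_def)
    have "(\<Sum>l\<in>insert (Inr i) (L J). dh l y * G' l j p) = 0" for j
      unfolding y_def
      by (rule relation_gradient[OF p _ F'[of _ "insert i J"] G'[of _ "insert i J"] h(1) _ h(4)])
         (use finL h(3) in \<open>auto simp: y_def ins\<close>)
    moreover have "G' (Inr i) j p = axis i 1 $ j" for j by (simp add: G'_def axis_def)
    ultimately have "dh (Inr i) y * axis i 1 $ j + (\<Sum>l\<in>L J. dh l y * r l $ j) = 0" for j
      using \<open>Inr i \<notin> L J\<close> finL by (simp add: r_def)
    then have "(\<Sum>l\<in>L J. dh l y * r l $ j) = - (dh (Inr i) y * axis i 1 $ j)" for j
      by (simp add: add_eq_0_iff)
    then have "axis i 1 = (\<Sum>l\<in>L J. (- dh l y / dh (Inr i) y) *s r l)"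
      using nz by (simp add: vec_eq_iff sum_negf sum_divide_distrib[symmetric])
    also have "\<dots> \<in> vec.span (r ` L J)"
      by (intro vec.span_sum vec.span_scale vec.span_base) auto
    finally show ?thesis .
  qed
  have span: "UNIV \<subseteq> vec.span (r ` L J)"
  proof
    fix v :: "complex ^ 'x"
    have "v = (\<Sum>i\<in>UNIV. v $ i *s axis i 1)" by (simp add: basis_expansion)
    also have "\<dots> \<in> vec.span (r ` L J)"
      by (intro vec.span_sum vec.span_scale axis)
    finally show "v \<in> vec.span (r ` L J)" .
  qed
  have "vec.dim (UNIV :: (complex ^ 'x) set) = CARD('x)" by (rule vec_dim_card)
  then have ge: "CARD('x) \<le> card (r ` L J)"
    using vec.dim_le_card[OF span] finL by simp
  have le: "card (r ` L J) \<le> card (L J)" by (rule card_image_le[OF finL])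
  have "inj_on r (L J)" using ge le card by (intro eq_card_imp_inj_on[OF finL]) simp
  moreover have "vec.independent (r ` L J)"
    using span le card finL by (intro vec.card_le_dim_spanning[of _ UNIV]) (auto simp: card_cart_basis)
  ultimately have ind: "\<forall>l\<in>L J. c l = 0" if "(\<Sum>l\<in>L J. c l *s r l) = 0" for c
    using vec.independent_family_iff[OF finL] that by blast
  have "(\<Sum>l\<in>L J. case_sum c (\<lambda>_. 0) l *s r l) = (\<Sum>l\<in>Inl ` K. case_sum c (\<lambda>_. 0) l *s r l)"
    using finL by (intro sum.mono_neutral_right) (auto simp: L_def)
  also have "\<dots> = (\<Sum>k\<in>K. c k *s r (Inl k))" by (simp add: sum.reindex)
  also have "\<dots> = 0" using zero by (simp add: vec_eq_iff r_def G'_def)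
  finally show ?thesis using ind \<open>k \<in> K\<close> by (force simp: L_def)
qed

text \<open>
  The conclusion holds at any \<open>q\<close> in the fibre of \<open>p\<close>, where the gradients may well satisfy further
  relations.  A nontrivial relation at \<open>p\<close> forces an algebraic relation \<open>h\<close>, whose gradient is a
  relation at \<open>p\<close> and, having the same entries there, at \<open>q\<close>; subtracting a multiple of it cancels
  one coefficient, and induction on the index set applies.
\<close>

lemma gradient_relation_persists:
  fixes F :: "'k \<Rightarrow> ('x::finite \<Rightarrow> complex) \<Rightarrow> complex"
  assumes p: "generic_point p" and "finite K"
    and F: "\<And>k. k \<in> K \<Longrightarrow> rat_poly UNIV d (F k)"
    and G: "\<And>k j x. k \<in> K \<Longrightarrow> ((\<lambda>t. F k (x(j := t))) has_field_derivative G k j x) (at (x j))"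
    and fibre: "\<And>k. k \<in> K \<Longrightarrow> F k q = F k p"
    and zero: "\<And>j. (\<Sum>k\<in>K. c k * G k j p) = 0"
  shows "(\<Sum>k\<in>K. c k * G k j q) = 0"
  using assms(2-)
proof (induction K arbitrary: c rule: finite_psubset_induct)
  case (psubset K c)
  show ?case
  proof (cases "\<forall>k\<in>K. c k = 0")
    case False
    define y where "y = (\<lambda>k. F k p)"
    have "algebraically_dependent K y"
      using jacobian_criterion[OF p psubset.hyps psubset.prems(1,2) _ psubset.prems(4)] False
      unfolding y_def by blast
    then obtain n h dh where h: "rat_poly K n h" "h \<noteq> (\<lambda>_. 0)" "h y = 0"
        "\<forall>k. rat_poly K (n - 1) (dh k)" "has_partials K h dh" "\<forall>k. dh k y = 0 \<longrightarrow> dh k = (\<lambda>_. 0)"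
      using minimal_relation[OF psubset.hyps] by blast
    have "\<exists>k0\<in>K. dh k0 y \<noteq> 0"
    proof (rule ccontr)
      assume "\<not> (\<exists>k0\<in>K. dh k0 y \<noteq> 0)"
      then have "dh k = (\<lambda>_. 0)" if "k \<in> K" for k using h(6) that by blast
      then have "h z = h y" for z by (intro zero_partials_imp_eq[OF h(5)]) blast
      with h(2,3) show False by auto
    qed
    then obtain k0 where k0: "k0 \<in> K" "dh k0 y \<noteq> 0" by blast
    have bp: "(\<Sum>k\<in>K. dh k y * G k j p) = 0" for j
      unfolding y_def
      by (rule relation_gradient[OF p psubset.hyps psubset.prems(1,2) h(1) _ h(5)])
         (use h(3) in \<open>auto simp: y_def\<close>)
    have "dh k (\<lambda>k. F k q) = dh k y" for k
      by (rule rat_poly_cong[OF spec[OF h(4)]]) (use psubset.prems(3) in \<open>auto simp: y_def\<close>)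
    moreover have "(\<Sum>k\<in>K. dh k (\<lambda>k. F k q) * G k j q) = 0"
      by (rule relation_gradient[OF p psubset.hyps psubset.prems(1,2) h(1) _ h(5)])
         (use h(3) in \<open>auto simp: y_def\<close>)
    ultimately have bq: "(\<Sum>k\<in>K. dh k y * G k j q) = 0" by simp
    \<comment> \<open>The multiple for which the coefficient of \<open>k0\<close> cancels.\<close>
    define a where "a = c k0 / dh k0 y"
    define c' where "c' k = c k - a * dh k y" for k
    have split: "(\<Sum>k\<in>K. c' k * g k) = (\<Sum>k\<in>K. c k * g k) - a * (\<Sum>k\<in>K. dh k y * g k)" for g
      by (simp add: c'_def left_diff_distrib sum_subtractf sum_distrib_left mult.assoc)
    have "c' k0 = 0" using k0 by (simp add: c'_def a_def)
    then have drop: "(\<Sum>k\<in>K - {k0}. c' k * g k) = (\<Sum>k\<in>K. c' k * g k)" for g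
      using psubset.hyps k0 by (simp add: sum.remove)
    have "(\<Sum>k\<in>K - {k0}. c' k * G k j q) = 0"
      using psubset.prems k0 bp
      by (intro psubset.IH) (auto simp: drop split)
    with bq show ?thesis by (simp add: drop split)
  qed simp
qed

section \<open>Linear systems with polynomial coefficients\<close>

definition rat_polynomial :: "(('x \<Rightarrow> complex) \<Rightarrow> complex) \<Rightarrow> bool" where
  "rat_polynomial f \<longleftrightarrow> (\<exists>n. rat_poly UNIV n f)"

lemma rat_polynomial_const [intro]: "rat_polynomial (\<lambda>_. of_rat c)"
  unfolding rat_polynomial_def by (blast intro: rat_poly.const)

lemma rat_polynomial_0 [intro, simp]: "rat_polynomial (\<lambda>_. 0)"
  and rat_polynomial_1 [intro, simp]: "rat_polynomial (\<lambda>_. 1)"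
  using rat_polynomial_const[of 0] rat_polynomial_const[of 1] by simp_all

lemma rat_polynomial_coord [intro]: "rat_polynomial (\<lambda>x. x j)"
  unfolding rat_polynomial_def by (blast intro: rat_poly.var)

lemma rat_polynomial_mult [intro]:
  "rat_polynomial f \<Longrightarrow> rat_polynomial g \<Longrightarrow> rat_polynomial (\<lambda>x. f x * g x)"
  unfolding rat_polynomial_def by (blast intro: rat_poly.mult)

lemma rat_polynomial_add [intro]:
  assumes "rat_polynomial f" and "rat_polynomial g"
  shows "rat_polynomial (\<lambda>x. f x + g x)"
proof -
  from assms obtain m n where "rat_poly UNIV m f" "rat_poly UNIV n g"
    unfolding rat_polynomial_def by blast
  then have "rat_poly UNIV (max m n) f" "rat_poly UNIV (max m n) g"
    by (auto intro: rat_poly_mono_degree)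
  then show ?thesis unfolding rat_polynomial_def by (blast intro: rat_poly.add)
qed

lemma rat_polynomial_uminus [intro]:
  assumes "rat_polynomial f" shows "rat_polynomial (\<lambda>x. - f x)"
  using rat_polynomial_mult[OF rat_polynomial_const[of "-1"] assms] by simp

lemma rat_polynomial_diff [intro]:
  "rat_polynomial f \<Longrightarrow> rat_polynomial g \<Longrightarrow> rat_polynomial (\<lambda>x. f x - g x)"
  using rat_polynomial_add[of f "\<lambda>x. - g x"] rat_polynomial_uminus[of g] by simp

lemma rat_polynomial_sum [intro]:
  "(\<And>i. i \<in> I \<Longrightarrow> rat_polynomial (f i)) \<Longrightarrow> rat_polynomial (\<lambda>x. \<Sum>i\<in>I. f i x)"
  by (induction I rule: infinite_finite_induct) auto

lemma generic_point_nonzero: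
  assumes "generic_point x" and "rat_polynomial f" and "f \<noteq> (\<lambda>_. 0)"
  shows "f x \<noteq> 0"
  using assms unfolding generic_point_def rat_polynomial_def by blast

text \<open>
  The members of \<open>A\<close> are the free variables of the linear system with rows \<open>R\<close> and unknowns \<open>I\<close>, and
  \<open>D\<close> is the common denominator.  Wherever \<open>D\<close> does not vanish, the vectors \<open>s k\<close> are a basis of the
  solutions: they are solutions identically, they are \<open>D\<close> times unit vectors on \<open>A\<close>, and the last
  clause is Cramer's rule expressing a solution by its free entries.
\<close>

definition solution_basis ::
  "('i \<Rightarrow> ('x \<Rightarrow> complex) \<Rightarrow> complex) set \<Rightarrow> 'i set \<Rightarrow> 'i set \<Rightarrow> (('x \<Rightarrow> complex) \<Rightarrow> complex) \<Rightarrow>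
    ('i \<Rightarrow> 'i \<Rightarrow> ('x \<Rightarrow> complex) \<Rightarrow> complex) \<Rightarrow> bool" where
  "solution_basis R I A D s \<longleftrightarrow> A \<subseteq> I \<and> rat_polynomial D \<and> D \<noteq> (\<lambda>_. 0) \<and>
    (\<forall>k\<in>A. \<forall>i\<in>I. rat_polynomial (s k i)) \<and>
    (\<forall>k\<in>A. \<forall>i\<in>A. \<forall>x. s k i x = (if i = k then D x else 0)) \<and>
    (\<forall>k\<in>A. \<forall>a\<in>R. \<forall>x. (\<Sum>i\<in>I. a i x * s k i x) = 0) \<and>
    (\<forall>x c. (\<forall>a\<in>R. (\<Sum>i\<in>I. a i x * c i) = 0) \<longrightarrow>
       (\<forall>i\<in>I. D x * c i = (\<Sum>k\<in>A. c k * s k i x)))"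

text \<open>
  Gaussian elimination without division.  Only the vanishing of a pivot as a polynomial is tested, so
  the result does not depend on the point of evaluation.  The generic point in the hypothesis serves
  to see that a product of nonzero polynomials is nonzero.
\<close>

lemma polynomial_linear_system:
  fixes R :: "('i \<Rightarrow> ('x \<Rightarrow> complex) \<Rightarrow> complex) set"
  assumes x0: "generic_point (x0 :: 'x \<Rightarrow> complex)" and "finite I"
    and "\<forall>a\<in>R. \<forall>i\<in>I. rat_polynomial (a i)"
  shows "\<exists>A D s. solution_basis R I A D s"
  using assms(2,3)
proof (induction I arbitrary: R rule: finite_psubset_induct)
  case (psubset I R)
  show ?case
  proof (cases "\<forall>a\<in>R. \<forall>i\<in>I. a i = (\<lambda>_. 0)")
    case True
    have "(\<Sum>k\<in>I. c k * (if i = k then 1 else 0)) = c i" if "i \<in> I" for c :: "'i \<Rightarrow> complex" and i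
      using that psubset.hyps by (simp add: if_distrib[of "\<lambda>b. _ * b"] cong: if_cong)
    with True show ?thesis
      by (intro exI[of _ I] exI[of _ "\<lambda>_. 1"] exI[of _ "\<lambda>k i _. if i = k then 1 else 0"])
         (auto simp: fun_eq_iff solution_basis_def)
  next
    case False
    then obtain a0 j where a0: "a0 \<in> R" and j: "j \<in> I" and pivot: "a0 j \<noteq> (\<lambda>_. 0)" by blast
    define I' where "I' = I - {j}"
    \<comment> \<open>The row operation that eliminates the unknown \<open>j\<close> from the row \<open>a\<close>.\<close>
    define elim where "elim a i x = a0 j x * a i x - a j x * a0 i x" for a i x
    have I': "I' \<subset> I" "finite I'" and I: "I = insert j I'" "j \<notin> I'"
      using j psubset.hyps by (auto simp: I'_def)
    have rat: "rat_polynomial (a i)" if "a \<in> R" "i \<in> I" for a i using psubset.prems that by blast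
    have elim: "\<forall>a\<in>elim ` R. \<forall>i\<in>I'. rat_polynomial (a i)"
    proof (intro ballI)
      fix a i assume ai: "a \<in> elim ` R" "i \<in> I'"
      obtain b where b: "b \<in> R" "a = elim b" using ai by blast
      have "rat_polynomial (\<lambda>x. a0 j x * b i x - b j x * a0 i x)"
        using ai I(1) by (intro rat_polynomial_diff rat_polynomial_mult rat a0 b j) auto
      then show "rat_polynomial (a i)" using b by (simp add: elim_def[abs_def])
    qed
    from psubset.IH[OF I'(1) this] obtain A D s where sb: "solution_basis (elim ` R) I' A D s"
      by blast
    have A: "A \<subseteq> I'" and D: "rat_polynomial D" "D \<noteq> (\<lambda>_. 0)"
      and s: "\<forall>k\<in>A. \<forall>i\<in>I'. rat_polynomial (s k i)"
        "\<forall>k\<in>A. \<forall>i\<in>A. \<forall>x. s k i x = (if i = k then D x else 0)"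
        "\<forall>k\<in>A. \<forall>a\<in>elim ` R. \<forall>x. (\<Sum>i\<in>I'. a i x * s k i x) = 0"
      and complete: "\<forall>x c. (\<forall>a\<in>elim ` R. (\<Sum>i\<in>I'. a i x * c i) = 0) \<longrightarrow>
          (\<forall>i\<in>I'. D x * c i = (\<Sum>k\<in>A. c k * s k i x))"
      using sb unfolding solution_basis_def by simp_all
    \<comment> \<open>Back substitution: the entry \<open>j\<close> is determined by the row of the pivot, and the other
      entries are scaled by the pivot to avoid dividing by it.\<close>
    define t where "t k i x =
      (if i = j then - (\<Sum>i\<in>I'. s k i x * a0 i x) else a0 j x * s k i x)" for k i x
    have 1: "rat_polynomial (\<lambda>x. a0 j x * D x)" using rat[OF a0 j] D by blast
    have 2: "(\<lambda>x. a0 j x * D x) \<noteq> (\<lambda>_. 0)"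
      using generic_point_nonzero[OF x0 rat[OF a0 j] pivot] generic_point_nonzero[OF x0 D]
      by (metis mult_eq_0_iff)
    have 3: "rat_polynomial (t k i)" if "k \<in> A" "i \<in> I" for k i
    proof (cases "i = j")
      case True
      have "rat_polynomial (\<lambda>x. - (\<Sum>i\<in>I'. s k i x * a0 i x))"
        using s(1) that I(1) by (intro rat_polynomial_uminus rat_polynomial_sum rat_polynomial_mult rat[OF a0]) auto
      with True show ?thesis by (simp add: t_def[abs_def])
    next
      case False
      then have "rat_polynomial (\<lambda>x. a0 j x * s k i x)"
        using s(1) that I(1) by (intro rat_polynomial_mult rat[OF a0 j]) auto
      with False show ?thesis by (simp add: t_def[abs_def])
    qed
    have 4: "t k i x = (if i = k then a0 j x * D x else 0)" if "k \<in> A" "i \<in> A" for k i x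
      using s(2) that A I(2) by (auto simp: t_def)
    have 5: "(\<Sum>i\<in>I. a i x * t k i x) = 0" if "k \<in> A" "a \<in> R" for k a x
    proof -
      have "(\<Sum>i\<in>I. a i x * t k i x) = a j x * t k j x + (\<Sum>i\<in>I'. a i x * t k i x)"
        using I I'(2) by simp
      also have "(\<Sum>i\<in>I'. a i x * t k i x) = (\<Sum>i\<in>I'. a i x * (a0 j x * s k i x))"
        using I(2) by (intro sum.cong) (auto simp: t_def)
      also have "a j x * t k j x + (\<Sum>i\<in>I'. a i x * (a0 j x * s k i x)) = (\<Sum>i\<in>I'. elim a i x * s k i x)"
        by (simp add: t_def elim_def algebra_simps sum_subtractf sum_distrib_left)
      also have "\<dots> = 0" using s(3) that by blast
      finally show ?thesis .
    qed
    have 6: "a0 j x * D x * c i = (\<Sum>k\<in>A. c k * t k i x)"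
      if c: "\<forall>a\<in>R. (\<Sum>i\<in>I. a i x * c i) = 0" and "i \<in> I" for x c i
    proof -
      have row: "(\<Sum>i\<in>I'. a i x * c i) = - (a j x * c j)" if "a \<in> R" for a
        using c that I I'(2) by (simp add: add_eq_0_iff)
      have "(\<Sum>i\<in>I'. elim a i x * c i) = 0" if "a \<in> R" for a
      proof -
        have "(\<Sum>i\<in>I'. elim a i x * c i) =
            a0 j x * (\<Sum>i\<in>I'. a i x * c i) - a j x * (\<Sum>i\<in>I'. a0 i x * c i)"
          by (simp add: elim_def algebra_simps sum_subtractf sum_distrib_left)
        then show ?thesis using row[OF that] row[OF a0] by simp
      qed
      then have sol: "D x * c i = (\<Sum>k\<in>A. c k * s k i x)" if "i \<in> I'" for i
        using complete that by blast
      show ?thesis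
      proof (cases "i = j")
        case True
        have "a0 j x * D x * c j = - (D x * (\<Sum>i\<in>I'. a0 i x * c i))"
          by (simp add: row[OF a0])
        also have "\<dots> = - (\<Sum>i\<in>I'. a0 i x * (D x * c i))"
          by (simp add: sum_distrib_left mult_ac)
        also have "\<dots> = - (\<Sum>i\<in>I'. \<Sum>k\<in>A. c k * (s k i x * a0 i x))"
          by (simp add: sol sum_distrib_left mult_ac)
        also have "\<dots> = (\<Sum>k\<in>A. c k * t k j x)"
          by (subst sum.swap) (simp add: t_def sum_distrib_left sum_negf)
        finally show ?thesis using True by simp
      next
        case False
        with \<open>i \<in> I\<close> I have "i \<in> I'" by simp
        then have "a0 j x * D x * c i = a0 j x * (\<Sum>k\<in>A. c k * s k i x)"
          by (simp add: sol mult.assoc)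
        then show ?thesis using False by (simp add: t_def sum_distrib_left mult_ac)
      qed
    qed
    have "solution_basis R I A (\<lambda>x. a0 j x * D x) t"
      unfolding solution_basis_def
      by (intro conjI ballI allI impI 1 2 3 4 5 6) (use A I'(1) in auto)
    then show ?thesis by blast
  qed
qed

text \<open>
  A free variable would give a solution that is nonzero at \<open>x\<close>, and without free variables the system
  has only the trivial solution wherever the denominator does not vanish.
\<close>

lemma trivial_solutions_transfer:
  fixes R :: "('i \<Rightarrow> ('x \<Rightarrow> complex) \<Rightarrow> complex) set"
  assumes x: "generic_point x" and y: "generic_point y" and I: "finite I"
    and R: "\<forall>a\<in>R. \<forall>i\<in>I. rat_polynomial (a i)"
    and trivial: "\<And>c. \<forall>a\<in>R. (\<Sum>i\<in>I. a i x * c i) = 0 \<Longrightarrow> \<forall>i\<in>I. c i = 0"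
    and c: "\<forall>a\<in>R. (\<Sum>i\<in>I. a i y * c i) = 0"
  shows "\<forall>i\<in>I. c i = 0"
proof -
  from polynomial_linear_system[OF x I R] obtain A D s where sb: "solution_basis R I A D s"
    by blast
  have A: "A \<subseteq> I"
    and D: "rat_polynomial D" "D \<noteq> (\<lambda>_. 0)"
    and diag: "\<forall>k\<in>A. \<forall>i\<in>A. \<forall>x. s k i x = (if i = k then D x else 0)"
    and sol: "\<forall>k\<in>A. \<forall>a\<in>R. \<forall>x. (\<Sum>i\<in>I. a i x * s k i x) = 0"
    and complete: "\<forall>x c. (\<forall>a\<in>R. (\<Sum>i\<in>I. a i x * c i) = 0) \<longrightarrow>
       (\<forall>i\<in>I. D x * c i = (\<Sum>k\<in>A. c k * s k i x))"
    using sb unfolding solution_basis_def by simp_all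
  have "A = {}"
  proof (rule ccontr)
    assume "A \<noteq> {}"
    then obtain k where k: "k \<in> A" by blast
    then have "\<forall>i\<in>I. s k i x = 0" using sol by (intro trivial) blast
    moreover have "s k k x = D x" using k diag by simp
    ultimately have "D x = 0" using k A by auto
    with generic_point_nonzero[OF x D] show False ..
  qed
  with complete c have "\<forall>i\<in>I. D y * c i = 0" by simp
  with generic_point_nonzero[OF y D] show ?thesis by simp
qed

text \<open>
  The dimension is the number of free variables, and these are the same at all generic points.
\<close>

lemma generic_solution_dim:
  fixes R :: "('i::finite \<Rightarrow> ('x \<Rightarrow> complex) \<Rightarrow> complex) set"
  assumes x0: "generic_point (x0 :: 'x \<Rightarrow> complex)"
    and R: "\<forall>a\<in>R. \<forall>i\<in>UNIV. rat_polynomial (a i)"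
  shows "\<exists>n. \<forall>x. generic_point x \<longrightarrow>
    vec.dim {v :: complex ^ 'i. \<forall>a\<in>R. (\<Sum>i\<in>UNIV. a i x * v $ i) = 0} = n"
proof -
  from polynomial_linear_system[OF x0 finite_class.finite_UNIV R] obtain A D s where sb: "solution_basis R UNIV A D s"
    by auto
  have D: "rat_polynomial D" "D \<noteq> (\<lambda>_. 0)"
    and diag: "\<forall>k\<in>A. \<forall>i\<in>A. \<forall>x. s k i x = (if i = k then D x else 0)"
    and sol: "\<forall>k\<in>A. \<forall>a\<in>R. \<forall>x. (\<Sum>i\<in>UNIV. a i x * s k i x) = 0"
    and complete: "\<forall>x c. (\<forall>a\<in>R. (\<Sum>i\<in>UNIV. a i x * c i) = 0) \<longrightarrow>
       (\<forall>i\<in>UNIV. D x * c i = (\<Sum>k\<in>A. c k * s k i x))"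
    using sb unfolding solution_basis_def by simp_all
  have "vec.dim {v :: complex ^ 'i. \<forall>a\<in>R. (\<Sum>i\<in>UNIV. a i x * v $ i) = 0} = card A"
    if x: "generic_point x" for x
  proof -
    let ?V = "{v :: complex ^ 'i. \<forall>a\<in>R. (\<Sum>i\<in>UNIV. a i x * v $ i) = 0}"
    define b where "b k = (\<chi> i. s k i x)" for k
    have Dx: "D x \<noteq> 0" by (rule generic_point_nonzero[OF x D])
    have "\<forall>k\<in>A. c k = 0" if "(\<Sum>k\<in>A. c k *s b k) = 0" for c
    proof
      fix i assume "i \<in> A"
      have "0 = (\<Sum>k\<in>A. c k *s b k) $ i" using that by simp
      also have "\<dots> = (\<Sum>k\<in>A. c k * s k i x)"
        by (simp add: b_def)
      also have "\<dots> = (\<Sum>k\<in>A. if k = i then c i * D x else 0)"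
        using diag \<open>i \<in> A\<close> by (intro sum.cong) auto
      also have "\<dots> = c i * D x" using \<open>i \<in> A\<close> by simp
      finally show "c i = 0" using Dx by simp
    qed
    then have b: "inj_on b A" "vec.independent (b ` A)"
      using vec.independent_family_iff[of A b] by auto
    have "?V \<subseteq> vec.span (b ` A)"
    proof
      fix v assume "v \<in> ?V"
      then have "D x * v $ i = (\<Sum>k\<in>A. v $ k * s k i x)" for i
        using complete[rule_format, of x "\<lambda>i. v $ i"] by blast
      then have "v = (\<Sum>k\<in>A. (v $ k / D x) *s b k)"
        using Dx by (simp add: vec_eq_iff b_def sum_divide_distrib[symmetric] field_simps)
      also have "\<dots> \<in> vec.span (b ` A)"
        by (intro vec.span_sum vec.span_scale vec.span_base) auto
      finally show "v \<in> vec.span (b ` A)" .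
    qed
    moreover have "b ` A \<subseteq> ?V" using sol by (auto simp: b_def)
    ultimately show ?thesis
      using b by (intro vec.dim_unique[of "b ` A"]) (auto simp: card_image)
  qed
  then show ?thesis by blast
qed

section \<open>Stresses and the rigidity matroid\<close>

text \<open>
  Realizations are identified with points whose coordinates are indexed by pairs of a vertex and a
  direction, in order to apply the results on polynomial functions.
\<close>

definition configuration :: "('v::finite \<times> 'd::finite \<Rightarrow> complex) \<Rightarrow> complex ^ 'd ^ 'v" where
  "configuration x = (\<chi> w i. x (w, i))"

definition coordinates :: "complex ^ 'd::finite ^ 'v::finite \<Rightarrow> 'v \<times> 'd \<Rightarrow> complex" where
  "coordinates p = (\<lambda>(w, i). p $ w $ i)"

lemma configuration_coordinates [simp]: "configuration (coordinates p) = p"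
  by (simp add: configuration_def coordinates_def vec_eq_iff)

lemma configuration_nth [simp]: "configuration x $ w $ i = x (w, i)"
  by (simp add: configuration_def)

lemma simple_graphE:
  assumes "simple_graph E" and "e \<in> E"
  obtains a b where "e = {a, b}" "a \<noteq> b"
  using assms unfolding simple_graph_def by (metis card_2_iff)

lemma rat_poly_sqdist:
  "rat_poly UNIV 2 (\<lambda>x. sqdist (configuration x :: complex ^ 'd::finite ^ 'v::finite) a b)"
proof -
  have "rat_poly UNIV 1 (\<lambda>x. x (a, i) + of_rat (-1) * x (b, i))" for i :: 'd
    using rat_poly.var[of _ UNIV 0] rat_poly.mult[OF rat_poly.const[of UNIV 0 "-1"]]
    by (intro rat_poly.add) fastforce+
  then have "rat_poly UNIV 2 (\<lambda>x. (x (a, i) + of_rat (-1) * x (b, i))\<^sup>2)" for i :: 'd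
    using rat_poly_power[where m = 2 and n = 1] by fastforce
  then have "rat_poly UNIV 2 (\<lambda>x. \<Sum>i\<in>UNIV. (x (a, i) + of_rat (-1) * x (b, i :: 'd))\<^sup>2)"
    by (rule rat_poly_sum)
  then show ?thesis by (simp add: sqdist_def)
qed

lemma jacobian_row_derivative:
  fixes x :: "'v::finite \<times> 'd::finite \<Rightarrow> complex"
  assumes "simple_graph E" and "e \<in> E"
  shows "((\<lambda>t. edge_sqdist (configuration (x(j := t)) :: complex ^ 'd ^ 'v) e)
    has_field_derivative jacobian_row E (configuration x) e $ j) (at (x j))"
proof -
  obtain a b where e: "e = {a, b}" "a \<noteq> b" using assms by (rule simple_graphE)
  obtain w i where j: "j = (w, i)" by force
  define D where "D = (if w = a then 2 * (x (a, i) - x (b, i))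
    else if w = b then 2 * (x (b, i) - x (a, i)) else 0)"
  have "((\<lambda>t. ((x(j := t)) (a, l) - (x(j := t)) (b, l))\<^sup>2) has_field_derivative
      (if l = i then D else 0)) (at (x j))" for l
    using e(2) unfolding j D_def
    by (cases "l = i"; cases "w = a"; cases "w = b") (auto intro!: derivative_eq_intros)
  then have "((\<lambda>t. \<Sum>l\<in>UNIV. ((x(j := t)) (a, l) - (x(j := t)) (b, l))\<^sup>2) has_field_derivative
      (\<Sum>l\<in>UNIV. if l = i then D else 0)) (at (x j))"
    by (rule DERIV_sum)
  moreover have "jacobian_row E (configuration x) e $ j = D"
    using assms(2) e by (simp add: j jacobian_row_pair D_def)
  ultimately show ?thesis by (simp add: e sqdist_def del: fun_upd_apply)
qed

lemma rat_polynomial_jacobian_row: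
  assumes "simple_graph E" and "e \<in> E"
  shows "rat_polynomial (\<lambda>x. jacobian_row E (configuration x :: complex ^ 'd::finite ^ 'v::finite) e $ j)"
proof -
  obtain a b where e: "e = {a, b}" "a \<noteq> b" using assms by (rule simple_graphE)
  obtain w i where j: "j = (w, i)" by force
  have diff: "rat_polynomial (\<lambda>x. 2 * (x (c, i) - x (c', i)))" for c c'
    using rat_polynomial_mult[OF rat_polynomial_const[of 2]
        rat_polynomial_diff[OF rat_polynomial_coord[of "(c, i)"] rat_polynomial_coord[of "(c', i)"]]]
    by simp
  show ?thesis
    using assms(2) e(2) diff unfolding e(1)
    by (cases "w = a"; cases "w = b") (simp_all add: j jacobian_row_pair)
qed

text \<open>
  An edge contributes to the column of \<open>(w, i)\<close> only if it contains \<open>w\<close>, and the edges at \<open>w\<close>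
  correspond to the neighbours of \<open>w\<close>.
\<close>

lemma sum_jacobian_rows:
  fixes p :: "complex ^ 'd::finite ^ 'v::finite"
  assumes "simple_graph E"
  shows "(\<Sum>e\<in>E. \<omega> e * jacobian_row E p e $ (w, i)) =
    2 * (\<Sum>u | {u, w} \<in> E. \<omega> {u, w} *s (p $ w - p $ u)) $ i"
proof -
  have "(\<Sum>e\<in>E. \<omega> e * jacobian_row E p e $ (w, i)) =
      (\<Sum>e | e \<in> E \<and> w \<in> e. \<omega> e * jacobian_row E p e $ (w, i))"
  proof (rule sum.mono_neutral_right)
    show "\<forall>e\<in>E - {e \<in> E. w \<in> e}. \<omega> e * jacobian_row E p e $ (w, i) = 0"
    proof
      fix e assume e: "e \<in> E - {e \<in> E. w \<in> e}"
      then obtain a b where "e = {a, b}" "a \<noteq> b" by (metis DiffD1 assms simple_graphE)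
      then show "\<omega> e * jacobian_row E p e $ (w, i) = 0"
        using e by (auto simp: jacobian_row_pair)
    qed
  qed auto
  also have "\<dots> = (\<Sum>u | {u, w} \<in> E. \<omega> {u, w} * jacobian_row E p {u, w} $ (w, i))"
  proof (rule sum.reindex_bij_betw[symmetric])
    have "{e \<in> E. w \<in> e} \<subseteq> (\<lambda>u. {u, w}) ` {u. {u, w} \<in> E}"
    proof
      fix e assume e: "e \<in> {e \<in> E. w \<in> e}"
      then obtain a b where "e = {a, b}" by (metis (lifting) assms mem_Collect_eq simple_graphE)
      with e show "e \<in> (\<lambda>u. {u, w}) ` {u. {u, w} \<in> E}"
        by (auto simp: insert_commute)
    qed
    then show "bij_betw (\<lambda>u. {u, w}) {u. {u, w} \<in> E} {e \<in> E. w \<in> e}"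
      by (auto simp: bij_betw_def inj_on_def doubleton_eq_iff)
  qed
  also have "\<dots> = (\<Sum>u | {u, w} \<in> E. 2 * (\<omega> {u, w} * (p $ w $ i - p $ u $ i)))"
  proof (rule sum.cong)
    fix u assume "u \<in> {u. {u, w} \<in> E}"
    then have uw: "{w, u} \<in> E" "w \<noteq> u"
      using assms by (auto simp: insert_commute simple_graph_def)
    show "\<omega> {u, w} * jacobian_row E p {u, w} $ (w, i) = 2 * (\<omega> {u, w} * (p $ w $ i - p $ u $ i))"
      using jacobian_row_pair[OF uw, of p w i] by (simp add: insert_commute)
  qed simp
  finally show ?thesis by (simp only: sum_distrib_left[symmetric] sum_component
      vector_smult_component vector_minus_component)
qed

lemma stresses_iff_jacobian:
  fixes p :: "complex ^ 'd::finite ^ 'v::finite"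
  assumes "simple_graph E"
  shows "\<omega> \<in> stresses E p \<longleftrightarrow>
    (\<forall>e. e \<notin> E \<longrightarrow> \<omega> e = 0) \<and> (\<forall>j. (\<Sum>e\<in>E. \<omega> e * jacobian_row E p e $ j) = 0)"
proof -
  have neg: "(\<Sum>u | {u, w} \<in> E. \<omega> {u, w} *s (p $ w - p $ u)) =
      - (\<Sum>u | {u, w} \<in> E. \<omega> {u, w} *s (p $ u - p $ w))" for w
    by (simp add: sum_negf[symmetric] vec_eq_iff algebra_simps)
  have "(\<forall>j. (\<Sum>e\<in>E. \<omega> e * jacobian_row E p e $ j) = 0) \<longleftrightarrow>
      (\<forall>w. (\<Sum>u | {u, w} \<in> E. \<omega> {u, w} *s (p $ u - p $ w)) = 0)"
    unfolding split_paired_All sum_jacobian_rows[OF assms] neg vec_eq_iff by simp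
  then show ?thesis by (simp add: stresses_def)
qed

lemma stresses_coordinates:
  fixes p :: "complex ^ 'd::finite ^ 'v::finite"
  shows "\<omega> \<in> stresses E p \<longleftrightarrow>
    (\<forall>i. \<omega> \<in> stresses E (one_dim_realization (\<chi> w. p $ w $ i)))"
  by (auto simp: stresses_def one_dim_realization_def vec_eq_iff)

text \<open>
  A stress is a relation between the gradients of the squared edge lengths at \<open>p\<close>, and \<open>q\<close> lies in the
  fibre of these functions through \<open>p\<close>.
\<close>

lemma stresses_fibre:
  fixes p q :: "complex ^ 'd::finite ^ 'v::finite"
  assumes "simple_graph E" and "generic p" and "measurement E p = measurement E q"
  shows "stresses E p \<subseteq> stresses E q"
proof
  fix \<omega> assume \<omega>: "\<omega> \<in> stresses E p"
  have gen: "generic_point (coordinates p)"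
    using generic_imp_generic_point[OF assms(2)] by (simp add: coordinates_def)
  have "(\<Sum>e\<in>E. \<omega> e * jacobian_row E (configuration (coordinates q)) e $ j) = 0" for j
  proof (rule gradient_relation_persists[OF gen, where d = 2
        and F = "\<lambda>e x. edge_sqdist (configuration x) e"
        and G = "\<lambda>e j x. jacobian_row E (configuration x) e $ j"])
    show "rat_poly UNIV 2 (\<lambda>x. edge_sqdist (configuration x :: complex ^ 'd ^ 'v) e)" if e: "e \<in> E" for e
    proof -
      obtain a b where "e = {a, b}" using assms(1) e by (rule simple_graphE)
      then show ?thesis using rat_poly_sqdist by simp
    qed
    show "edge_sqdist (configuration (coordinates q)) e = edge_sqdist (configuration (coordinates p)) e"
      if "e \<in> E" for e
      using fun_cong[OF assms(3), of e] that by (simp add: measurement_def)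
    show "(\<Sum>e\<in>E. \<omega> e * jacobian_row E (configuration (coordinates p)) e $ j) = 0" for j
      using \<omega> unfolding stresses_iff_jacobian[OF assms(1)] configuration_coordinates by blast
  qed (simp_all only: finite jacobian_row_derivative[OF assms(1)])
  with \<omega> show "\<omega> \<in> stresses E q" by (simp add: stresses_iff_jacobian[OF assms(1)])
qed

text \<open>
  The edge lengths are quadratic forms, so Euler's identity writes \<open>2 m\<^sub>e\<close> as the pairing of row
  \<open>e\<close> of the Jacobian with the realization itself; the combination of the rows by \<open>\<omega>\<close> is zero.
\<close>

lemma stress_energy_zero:
  fixes p :: "complex ^ 'd::finite ^ 'v::finite"
  assumes "simple_graph E" and "\<omega> \<in> stresses E p"
  shows "(\<Sum>e\<in>E. \<omega> e * edge_sqdist p e) = 0"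
proof -
  have euler: "(\<Sum>w\<in>UNIV. \<Sum>i\<in>UNIV. p $ w $ i * jacobian_row E p e $ (w, i)) = 2 * edge_sqdist p e"
    if E: "e \<in> E" for e
  proof -
    obtain a b where e: "e = {a, b}" "a \<noteq> b" using assms(1) E by (rule simple_graphE)
    have "(\<Sum>w\<in>UNIV. \<Sum>i\<in>UNIV. p $ w $ i * jacobian_row E p e $ (w, i)) =
        (\<Sum>w\<in>{a, b}. \<Sum>i\<in>UNIV. p $ w $ i * jacobian_row E p e $ (w, i))"
      using E e by (intro sum.mono_neutral_right) (auto simp: jacobian_row_pair)
    also have "\<dots> = (\<Sum>i\<in>UNIV. 2 * (p $ a $ i - p $ b $ i)\<^sup>2)"
      using E e by (simp add: jacobian_row_pair sum.distrib[symmetric] power2_eq_square algebra_simps)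
    finally show ?thesis by (simp add: e sqdist_def sum_distrib_left)
  qed
  have "2 * (\<Sum>e\<in>E. \<omega> e * edge_sqdist p e) = (\<Sum>e\<in>E. \<omega> e * (2 * edge_sqdist p e))"
    by (simp add: sum_distrib_left mult_ac)
  also have "\<dots> = (\<Sum>e\<in>E. \<omega> e * (\<Sum>j\<in>UNIV. p $ fst j $ snd j * jacobian_row E p e $ j))"
    by (intro sum.cong refl, subst euler[symmetric])
       (simp_all add: sum.cartesian_product split_beta flip: UNIV_Times_UNIV)
  also have "\<dots> = (\<Sum>e\<in>E. \<Sum>j\<in>UNIV. p $ fst j $ snd j * (\<omega> e * jacobian_row E p e $ j))"
    by (simp add: sum_distrib_left mult_ac)
  also have "\<dots> = (\<Sum>j\<in>UNIV. p $ fst j $ snd j * (\<Sum>e\<in>E. \<omega> e * jacobian_row E p e $ j))"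
    by (subst sum.swap) (simp add: sum_distrib_left)
  also have "\<dots> = 0"
    using assms(2) unfolding stresses_iff_jacobian[OF assms(1)] by (intro sum.neutral) simp
  finally show ?thesis by simp
qed

text \<open>
  Extension by zero identifies the stresses of a subgraph with the stresses supported on it.
\<close>

lemma stresses_subgraph:
  assumes "E \<subseteq> E'"
  shows "\<omega> \<in> stresses E p \<longleftrightarrow> \<omega> \<in> stresses E' p \<and> (\<forall>e. e \<notin> E \<longrightarrow> \<omega> e = 0)"
proof -
  have "(\<Sum>u | {u, v} \<in> E'. \<omega> {u, v} *s (p $ u - p $ v)) = (\<Sum>u | {u, v} \<in> E. \<omega> {u, v} *s (p $ u - p $ v))"
    if "\<forall>e. e \<notin> E \<longrightarrow> \<omega> e = 0" for v
    using assms that by (intro sum.mono_neutral_right) auto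
  with assms show ?thesis by (auto simp: stresses_def)
qed

lemma shared_stress_space_antimono:
  assumes "E \<subseteq> E'"
  shows "shared_stress_space E' p \<subseteq> shared_stress_space E p"
  by (auto simp: shared_stress_space_def stresses_subgraph[OF assms])

lemma shared_stress_space_iff:
  "q \<in> shared_stress_space E p \<longleftrightarrow>
    (\<forall>\<omega>\<in>stresses E p. \<forall>v. (\<Sum>u | {u, v} \<in> E. \<omega> {u, v} * (q $ u - q $ v)) = 0)"
proof -
  have "(\<Sum>u | {u, v} \<in> E. \<omega> {u, v} *s (one_dim_realization q $ u - one_dim_realization q $ v)) = 0 \<longleftrightarrow>
      (\<Sum>u | {u, v} \<in> E. \<omega> {u, v} * (q $ u - q $ v)) = 0" for \<omega> v
    unfolding vec_eq_iff sum_component vector_smult_component vector_minus_component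
    by (simp add: one_dim_realization_def)
  then show ?thesis by (auto simp: shared_stress_space_def stresses_def subset_iff)
qed

lemma subspace_shared_stress_space: "vec.subspace (shared_stress_space E p)"
proof (rule vec.subspaceI)
  fix q q' c
  assume q: "q \<in> shared_stress_space E p"
  then show "c *s q \<in> shared_stress_space E p"
    by (simp add: shared_stress_space_iff right_diff_distrib[symmetric] mult.left_commute[of _ c]
        sum_distrib_left[symmetric])
  assume "q' \<in> shared_stress_space E p"
  with q show "q + q' \<in> shared_stress_space E p"
    by (simp add: shared_stress_space_iff add_diff_add distrib_left sum.distrib)
qed (simp add: shared_stress_space_iff)

lemma rigidity_matroid_iff:
  fixes p :: "complex ^ 'd::finite ^ 'v::finite"
  shows "F \<in> rigidity_matroid E p \<longleftrightarrow> F \<subseteq> E \<and>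
    (\<forall>c. (\<forall>j. (\<Sum>e\<in>F. jacobian_row E p e $ j * c e) = 0) \<longrightarrow> (\<forall>e\<in>F. c e = 0))"
  unfolding rigidity_matroid_def mem_Collect_eq vec.independent_family_iff[OF finite]
  by (simp add: vec_eq_iff mult.commute)

text \<open>
  Independence of a set of rows means that a linear system with polynomial coefficients has only
  the trivial solution.
\<close>

lemma rigidity_matroid_generic:
  fixes p p' :: "complex ^ 'd::finite ^ 'v::finite"
  assumes "simple_graph E" and "generic p" and "generic p'"
  shows "rigidity_matroid E p \<subseteq> rigidity_matroid E p'"
proof
  fix F assume F: "F \<in> rigidity_matroid E p"
  let ?R = "range (\<lambda>j e x. jacobian_row E (configuration x :: complex ^ 'd ^ 'v) e $ j)"
  have "\<forall>a\<in>?R. \<forall>e\<in>F. rat_polynomial (a e)"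
    using F assms(1) by (auto simp: rigidity_matroid_iff intro!: rat_polynomial_jacobian_row)
  note transfer = trivial_solutions_transfer[OF
      generic_imp_generic_point[OF assms(2), folded coordinates_def]
      generic_imp_generic_point[OF assms(3), folded coordinates_def] finite this]
  have "\<forall>e\<in>F. c e = 0" if "\<forall>j. (\<Sum>e\<in>F. jacobian_row E p' e $ j * c e) = 0" for c
    by (rule transfer) (use F that in \<open>auto simp: rigidity_matroid_iff\<close>)
  with F show "F \<in> rigidity_matroid E p'" by (simp add: rigidity_matroid_iff)
qed

lemma generic_rigidity_matroid_eq:
  fixes p :: "complex ^ 'd::finite ^ 'v::finite"
  assumes "simple_graph E" and "generic p"
  shows "generic_rigidity_matroid TYPE('d) E = rigidity_matroid E p"
  unfolding generic_rigidity_matroid_def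
proof (rule the_equality)
  show "\<forall>p' :: complex ^ 'd ^ 'v. generic p' \<longrightarrow> rigidity_matroid E p' = rigidity_matroid E p"
    using assms rigidity_matroid_generic by blast
qed (use assms(2) in blast)

text \<open>
  Two linear systems are solved in turn.  The stresses form the solution space of the first one and
  have a polynomial basis at generic realizations.  Requiring the elements of this basis to be
  stresses of \<open>q\<close> is a second system, with unknown \<open>q\<close> and again with polynomial coefficients, whose
  solution space is the shared stress space.
\<close>

lemma shared_stress_nullity_eq:
  fixes p :: "complex ^ 'd::finite ^ 'v::finite"
  assumes E: "simple_graph E" and p: "generic p"
  shows "shared_stress_nullity TYPE('d) E = vec.dim (shared_stress_space E p)"
proof -
  have gen: "generic_point (coordinates p')" if "generic p'" for p' :: "complex ^ 'd ^ 'v"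
    using generic_imp_generic_point[OF that] by (simp add: coordinates_def)
  let ?J = "range (\<lambda>j e x. jacobian_row E (configuration x :: complex ^ 'd ^ 'v) e $ j)"
  have "\<forall>a\<in>?J. \<forall>e\<in>E. rat_polynomial (a e)"
    using E by (auto intro!: rat_polynomial_jacobian_row)
  from polynomial_linear_system[OF gen[OF p] finite this] obtain A D s
    where sb: "solution_basis ?J E A D s" by blast
  have A: "A \<subseteq> E" and D: "rat_polynomial D" "D \<noteq> (\<lambda>_. 0)"
    and rat: "\<forall>k\<in>A. \<forall>e\<in>E. rat_polynomial (s k e)"
    and sol: "\<And>k j x. k \<in> A \<Longrightarrow> (\<Sum>e\<in>E. jacobian_row E (configuration x) e $ j * s k e x) = 0"
    and complete: "\<And>x c e. \<forall>j. (\<Sum>e\<in>E. jacobian_row E (configuration x) e $ j * c e) = 0 \<Longrightarrow>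
       e \<in> E \<Longrightarrow> D x * c e = (\<Sum>k\<in>A. c k * s k e x)"
    using sb unfolding solution_basis_def by auto
  \<comment> \<open>The coefficient of \<open>q $ w\<close> in the equilibrium condition at \<open>v\<close> for the stress \<open>s k\<close> on \<open>q\<close>.\<close>
  define row where "row k v w x =
    (\<Sum>u | {u, v} \<in> E. s k {u, v} x * ((if u = w then 1 else 0) - (if v = w then 1 else 0)))"
    for k v w x
  define R where "R = {row k v | k v. k \<in> A}"
  have "\<forall>a\<in>R. \<forall>w\<in>UNIV. rat_polynomial (a w)"
  proof (intro ballI)
    fix a w assume "a \<in> R"
    then obtain k v where a: "a = row k v" "k \<in> A" by (auto simp: R_def)
    have "rat_polynomial (\<lambda>x :: 'v \<times> 'd \<Rightarrow> complex. (if u = w then 1 else 0) - (if v = w then 1 else 0))" for u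
      by (intro rat_polynomial_diff) auto
    then show "rat_polynomial (a w)"
      unfolding a(1) row_def[abs_def]
      using rat a(2) by (intro rat_polynomial_sum rat_polynomial_mult) auto
  qed
  from generic_solution_dim[OF gen[OF p] this] obtain n where
    n: "\<And>x. generic_point x \<Longrightarrow> vec.dim {q :: complex ^ 'v. \<forall>a\<in>R. (\<Sum>w\<in>UNIV. a w x * q $ w) = 0} = n"
    by blast
  have row: "(\<Sum>w\<in>UNIV. row k v w x * q $ w) = (\<Sum>u | {u, v} \<in> E. s k {u, v} x * (q $ u - q $ v))"
    for k v x and q :: "complex ^ 'v"
  proof -
    have delta: "(\<Sum>w\<in>UNIV. ((if u = w then 1 else 0) - (if v = w then 1 else 0)) * q $ w) = q $ u - q $ v"
      for u
      by (simp add: left_diff_distrib sum_subtractf if_distrib[of "\<lambda>b. b * _"] cong: if_cong)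
    have "(\<Sum>w\<in>UNIV. row k v w x * q $ w) = (\<Sum>u | {u, v} \<in> E. s k {u, v} x *
        (\<Sum>w\<in>UNIV. ((if u = w then 1 else 0) - (if v = w then 1 else 0)) * q $ w))"
      unfolding row_def sum_distrib_right sum_distrib_left by (subst sum.swap) (simp only: mult.assoc)
    then show ?thesis by (simp only: delta)
  qed
  have dim: "vec.dim (shared_stress_space E p') = n" if p': "generic p'" for p' :: "complex ^ 'd ^ 'v"
  proof -
    let ?x = "coordinates p'"
    have Dx: "D ?x \<noteq> 0" by (rule generic_point_nonzero[OF gen[OF p'] D])
    have "q \<in> shared_stress_space E p' \<longleftrightarrow> (\<forall>a\<in>R. (\<Sum>w\<in>UNIV. a w ?x * q $ w) = 0)" for q
    proof
      assume q: "q \<in> shared_stress_space E p'"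
      show "\<forall>a\<in>R. (\<Sum>w\<in>UNIV. a w ?x * q $ w) = 0"
      proof
        fix a assume "a \<in> R"
        then obtain k v where a: "a = row k v" "k \<in> A" by (auto simp: R_def)
        let ?\<omega> = "\<lambda>e. if e \<in> E then s k e ?x else 0"
        have "?\<omega> \<in> stresses E p'"
          unfolding stresses_iff_jacobian[OF E]
          using sol[OF a(2), of ?x] by (simp add: mult.commute cong: sum.cong)
        from bspec[OF q[unfolded shared_stress_space_iff] this]
        have "(\<Sum>u | {u, v} \<in> E. ?\<omega> {u, v} * (q $ u - q $ v)) = 0" by (rule spec)
        moreover have "(\<Sum>u | {u, v} \<in> E. ?\<omega> {u, v} * (q $ u - q $ v)) =
            (\<Sum>u | {u, v} \<in> E. s k {u, v} ?x * (q $ u - q $ v))"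
          by (intro sum.cong) auto
        ultimately show "(\<Sum>w\<in>UNIV. a w ?x * q $ w) = 0"
          by (simp only: a(1) row)
      qed
    next
      assume q: "\<forall>a\<in>R. (\<Sum>w\<in>UNIV. a w ?x * q $ w) = 0"
      show "q \<in> shared_stress_space E p'"
        unfolding shared_stress_space_iff
      proof (intro ballI allI)
        fix \<omega> v assume \<omega>: "\<omega> \<in> stresses E p'"
        have expand: "D ?x * \<omega> e = (\<Sum>k\<in>A. \<omega> k * s k e ?x)" if "e \<in> E" for e
          using \<omega> that unfolding stresses_iff_jacobian[OF E]
          by (intro complete) (simp_all add: mult.commute)
        have "D ?x * (\<Sum>u | {u, v} \<in> E. \<omega> {u, v} * (q $ u - q $ v)) =
            (\<Sum>u | {u, v} \<in> E. D ?x * \<omega> {u, v} * (q $ u - q $ v))"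
          by (simp only: sum_distrib_left mult.assoc)
        also have "\<dots> = (\<Sum>u | {u, v} \<in> E. \<Sum>k\<in>A. \<omega> k * (s k {u, v} ?x * (q $ u - q $ v)))"
          by (intro sum.cong refl) (simp only: mem_Collect_eq expand sum_distrib_right mult.assoc)
        also have "\<dots> = (\<Sum>k\<in>A. \<omega> k * (\<Sum>u | {u, v} \<in> E. s k {u, v} ?x * (q $ u - q $ v)))"
          by (subst sum.swap) (simp add: sum_distrib_left)
        also have "\<dots> = 0"
        proof (intro sum.neutral ballI)
          fix k assume "k \<in> A"
          then have "(\<Sum>w\<in>UNIV. row k v w ?x * q $ w) = 0" using q by (auto simp: R_def)
          then show "\<omega> k * (\<Sum>u | {u, v} \<in> E. s k {u, v} ?x * (q $ u - q $ v)) = 0"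
            by (simp add: row)
        qed
        finally show "(\<Sum>u | {u, v} \<in> E. \<omega> {u, v} * (q $ u - q $ v)) = 0" using Dx by simp
      qed
    qed
    then have "shared_stress_space E p' = {q. \<forall>a\<in>R. (\<Sum>w\<in>UNIV. a w ?x * q $ w) = 0}" by blast
    then show ?thesis using n[OF gen[OF p']] by simp
  qed
  show ?thesis
    unfolding shared_stress_nullity_def dim[OF p]
    by (rule the_equality) (use dim p in auto)
qed

text \<open>
  If no stress involved \<open>uv\<close>, then \<open>uv\<close> could be added to a maximal independent set of edges of \<open>G\<close>,
  and the rank would increase.
\<close>

lemma linked_imp_stress:
  fixes p :: "complex ^ 'd::finite ^ 'v::finite"
  assumes E: "simple_graph E" and "u \<noteq> v" and p: "generic p"
    and linked: "rigidity_linked TYPE('d) E u v" and new: "{u, v} \<notin> E"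
  obtains \<omega> where "\<omega> \<in> stresses (add_edge E u v) p" "\<omega> {u, v} \<noteq> 0"
proof -
  let ?E = "add_edge E u v" and ?M = "\<lambda>E. rigidity_matroid E p"
  have E': "simple_graph ?E" using E \<open>u \<noteq> v\<close> by (simp add: simple_graph_def add_edge_def)
  have rank: "Max (card ` ?M ?E) = Max (card ` ?M E)"
    using linked unfolding rigidity_linked_def rigidity_rank_def
    by (simp add: generic_rigidity_matroid_eq[OF E p] generic_rigidity_matroid_eq[OF E' p])
  have fin: "finite (card ` ?M E)" for E by (rule finite_imageI) (rule finite)
  have "{} \<in> ?M E" by (simp add: rigidity_matroid_iff)
  then have "Max (card ` ?M E) \<in> card ` ?M E" using fin by (intro Max_in) auto
  then obtain F where F: "F \<in> ?M E" "card F = Max (card ` ?M E)" by auto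
  let ?F = "insert {u, v} F"
  have "F \<subseteq> E" using F by (simp add: rigidity_matroid_iff)
  then have uvF: "{u, v} \<notin> F" using new by blast
  then have card: "card ?F = Suc (Max (card ` ?M ?E))" using F rank by simp
  have "?F \<notin> ?M ?E"
  proof
    assume "?F \<in> ?M ?E"
    then have "card ?F \<le> Max (card ` ?M ?E)" using fin by (intro Max_ge imageI)
    with card show False by simp
  qed
  moreover have "?F \<subseteq> ?E" using \<open>F \<subseteq> E\<close> by (auto simp: add_edge_def)
  ultimately obtain c where c: "\<forall>j. (\<Sum>e\<in>?F. jacobian_row ?E p e $ j * c e) = 0" and "\<exists>e\<in>?F. c e \<noteq> 0"
    by (auto simp: rigidity_matroid_iff)
  have row: "jacobian_row ?E p e = jacobian_row E p e" if "e \<in> F" for e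
    using that \<open>F \<subseteq> E\<close> by (simp add: jacobian_row_def measurement_def add_edge_def subset_iff cong: if_cong)
  have "c {u, v} \<noteq> 0"
  proof
    assume "c {u, v} = 0"
    then have "\<forall>j. (\<Sum>e\<in>F. jacobian_row E p e $ j * c e) = 0"
      using c uvF by (simp add: row cong: sum.cong)
    then have "\<forall>e\<in>F. c e = 0" using F by (simp add: rigidity_matroid_iff)
    with \<open>c {u, v} = 0\<close> \<open>\<exists>e\<in>?F. c e \<noteq> 0\<close> show False by auto
  qed
  moreover have "(\<lambda>e. if e \<in> ?F then c e else 0) \<in> stresses ?E p"
    unfolding stresses_iff_jacobian[OF E']
  proof (intro conjI allI)
    fix j
    have "(\<Sum>e\<in>?E. (if e \<in> ?F then c e else 0) * jacobian_row ?E p e $ j) =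
        (\<Sum>e\<in>?F. (if e \<in> ?F then c e else 0) * jacobian_row ?E p e $ j)"
      using \<open>?F \<subseteq> ?E\<close> by (intro sum.mono_neutral_right) auto
    also have "\<dots> = (\<Sum>e\<in>?F. jacobian_row ?E p e $ j * c e)" by (intro sum.cong) auto
    finally show "(\<Sum>e\<in>?E. (if e \<in> ?F then c e else 0) * jacobian_row ?E p e $ j) = 0"
      using c by simp
  qed (use \<open>?F \<subseteq> ?E\<close> in auto)
  ultimately show thesis using that by auto
qed

theorem theorem4p2:
  fixes E :: "'v::finite set set" and u v :: 'v
  assumes "simple_graph E"
    and "u \<noteq> v"
    and "stress_linked TYPE('d::finite) E u v"
  shows "globally_linked TYPE('d) E u v"
  unfolding globally_linked_def
proof (intro allI impI)
  fix p q :: "complex ^ 'd ^ 'v"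
  assume p: "generic p" and pq: "measurement E p = measurement E q"
  let ?E = "add_edge E u v"
  have E': "simple_graph ?E" and sub: "E \<subseteq> ?E"
    using assms(1,2) by (auto simp: simple_graph_def add_edge_def)
  have edge: "edge_sqdist p e = edge_sqdist q e" if "e \<in> E" for e
    using fun_cong[OF pq, of e] that by (simp add: measurement_def)
  show "sqdist p u v = sqdist q u v"
  proof (cases "{u, v} \<in> E")
    case True
    then show ?thesis using edge by force
  next
    case False
    obtain \<omega> where \<omega>: "\<omega> \<in> stresses ?E p" "\<omega> {u, v} \<noteq> 0"
      using linked_imp_stress[OF assms(1,2) p _ False] assms(3) unfolding stress_linked_def by blast
    have "vec.dim (shared_stress_space ?E p) = vec.dim (shared_stress_space E p)"
      using assms(3) unfolding stress_linked_def
      by (simp add: shared_stress_nullity_eq[OF assms(1) p] shared_stress_nullity_eq[OF E' p])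
    then have same: "shared_stress_space ?E p = shared_stress_space E p"
      by (intro vec.subspace_dim_equal subspace_shared_stress_space shared_stress_space_antimono sub) simp
    have "(\<chi> w. q $ w $ i) \<in> shared_stress_space E p" for i
      using stresses_fibre[OF assms(1) p pq] stresses_coordinates[of _ E q]
      unfolding shared_stress_space_def by blast
    then have "(\<chi> w. q $ w $ i) \<in> shared_stress_space ?E p" for i
      unfolding same .
    then have "\<omega> \<in> stresses ?E (one_dim_realization (\<chi> w. q $ w $ i))" for i
      using \<omega>(1) unfolding shared_stress_space_def by blast
    then have \<omega>q: "\<omega> \<in> stresses ?E q" using stresses_coordinates by blast
    have "(\<Sum>e\<in>E. \<omega> e * edge_sqdist p e) + \<omega> {u, v} * sqdist p u v = 0"
      using stress_energy_zero[OF E' \<omega>(1)] False by (simp add: add_edge_def add.commute)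
    moreover have "(\<Sum>e\<in>E. \<omega> e * edge_sqdist q e) + \<omega> {u, v} * sqdist q u v = 0"
      using stress_energy_zero[OF E' \<omega>q] False by (simp add: add_edge_def add.commute)
    ultimately have "\<omega> {u, v} * sqdist p u v = \<omega> {u, v} * sqdist q u v"
      by (simp add: edge add_eq_0_iff cong: sum.cong)
    with \<omega>(2) show ?thesis by simp
  qed
qed

end
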